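(* Let $\{f_n\}$ be a sequence of Laplace integrable functions on $[a,b]$ such that (A) there is a function $g$ Laplace integrable on $[a,b]$ with $f_n\geqslant g$ almost everywhere on $[a,b]$ for all $n\in\mathbb{N}$, and (B) $\lim_{n\to\infty}f_n=f$ almost everywhere on $[a,b]$ for a function $f\colon[a,b]\to\mathbb{R}$. Then [$f$ is Laplace integrable on $[a,b]$ and $\lim_{n\to\infty}\int_a^xf_n=\int_a^xf$ for all $x\in[a,b]$] if and only if the sequence of functions $x\mapsto\int_a^x(f_n-g)$ is equiabsolutely continuous on $[a,b]$.
   Context: Laplace integral on $[a,b]$: with lower/upper Laplace derivates $\underline{LD}_1F(x)$, $\overline{LD}_1F(x)$ being the minimum of the $\liminf$'s, resp. maximum of the $\limsup$'s, as $s\to\infty$ of $s^2\int_0^\delta e^{-st}[F(x+t)-F(x)]dt$ and $(-s^2)\int_0^\delta e^{-st}[F(x-t)-F(x)]dt$ (one-sided at endpoints), a major function of $f$ is a continuous $U$ with $\underline{LD}_1U\geqslant f$, $\underline{LD}_1U>-\infty$ everywhere on $[a,b]$, a minor function a continuous $V$ with $\overline{LD}_1V\leqslant f$, $\overline{LD}_1V<\infty$ everywhere, and $f$ is Laplace integrable if $\sup_V(V(b)-V(a))=\inf_U(U(b)-U(a))$ is finite, this value being $\int_a^bf$. A sequence $\{F_n\}$ of functions on $[a,b]$ is equiabsolutely continuous on $[a,b]$ if for every $\epsilon>0$ there is $\eta>0$ such that for every finite family of non-overlapping intervals $[x_i,y_i]\subseteq[a,b]$ with $\sum_i(y_i-x_i)<\eta$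 one has $\sum_i|F_n(y_i)-F_n(x_i)|<\epsilon$ for all $n$. *)

theory Defs
  imports "HOL-Analysis.Analysis"
begin

definition lap_right :: "(real \<Rightarrow> real) \<Rightarrow> real \<Rightarrow> real \<Rightarrow> real \<Rightarrow> real" where
  "lap_right F b x s = s\<^sup>2 * integral {0..b - x} (\<lambda>t. exp (- s * t) * (F (x + t) - F x))"

definition lap_left :: "(real \<Rightarrow> real) \<Rightarrow> real \<Rightarrow> real \<Rightarrow> real \<Rightarrow> real" where
  "lap_left F a x s = (- s\<^sup>2) * integral {0..x - a} (\<lambda>t. exp (- s * t) * (F (x - t) - F x))"

definition lower_LD :: "(real \<Rightarrow> real) \<Rightarrow> real \<Rightarrow> real \<Rightarrow> real \<Rightarrow> ereal" where
  "lower_LD F a b x =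
     Inf ((if x < b then {Liminf at_top (\<lambda>s. ereal (lap_right F b x s))} else {}) \<union>
          (if a < x then {Liminf at_top (\<lambda>s. ereal (lap_left F a x s))} else {}))"

definition upper_LD :: "(real \<Rightarrow> real) \<Rightarrow> real \<Rightarrow> real \<Rightarrow> real \<Rightarrow> ereal" where
  "upper_LD F a b x =
     Sup ((if x < b then {Limsup at_top (\<lambda>s. ereal (lap_right F b x s))} else {}) \<union>
          (if a < x then {Limsup at_top (\<lambda>s. ereal (lap_left F a x s))} else {}))"

definition laplace_major :: "(real \<Rightarrow> real) \<Rightarrow> real \<Rightarrow> real \<Rightarrow> (real \<Rightarrow> real) \<Rightarrow> bool" where
  "laplace_major f a b U \<longleftrightarrow> continuous_on {a..b} U \<and>
     (\<forall>x\<in>{a..b}. lower_LD U a b x \<ge> ereal (f x) \<and> lower_LD U a b x > - \<infinity>)"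

definition laplace_minor :: "(real \<Rightarrow> real) \<Rightarrow> real \<Rightarrow> real \<Rightarrow> (real \<Rightarrow> real) \<Rightarrow> bool" where
  "laplace_minor f a b V \<longleftrightarrow> continuous_on {a..b} V \<and>
     (\<forall>x\<in>{a..b}. upper_LD V a b x \<le> ereal (f x) \<and> upper_LD V a b x < \<infinity>)"

definition laplace_upper :: "(real \<Rightarrow> real) \<Rightarrow> real \<Rightarrow> real \<Rightarrow> ereal" where
  "laplace_upper f a b = (INF U\<in>{U. laplace_major f a b U}. ereal (U b - U a))"

definition laplace_lower :: "(real \<Rightarrow> real) \<Rightarrow> real \<Rightarrow> real \<Rightarrow> ereal" where
  "laplace_lower f a b = (SUP V\<in>{V. laplace_minor f a b V}. ereal (V b - V a))"

definition laplace_integrable :: "(real \<Rightarrow> real) \<Rightarrow> real \<Rightarrow> real \<Rightarrow> bool" where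
  "laplace_integrable f a b \<longleftrightarrow>
     laplace_lower f a b = laplace_upper f a b \<and> \<bar>laplace_upper f a b\<bar> \<noteq> \<infinity>"

definition laplace_integral :: "(real \<Rightarrow> real) \<Rightarrow> real \<Rightarrow> real \<Rightarrow> real" where
  "laplace_integral f a b = real_of_ereal (laplace_upper f a b)"

definition equiabs_continuous :: "(nat \<Rightarrow> real \<Rightarrow> real) \<Rightarrow> real \<Rightarrow> real \<Rightarrow> bool" where
  "equiabs_continuous F a b \<longleftrightarrow>
     (\<forall>\<epsilon>>0. \<exists>\<eta>>0. \<forall>S :: (real \<times> real) set.
        finite S \<longrightarrow>
        (\<forall>(x, y)\<in>S. a \<le> x \<and> x \<le> y \<and> y \<le> b) \<longrightarrow>
        (\<forall>p\<in>S. \<forall>q\<in>S. p \<noteq> q \<longrightarrow> snd p \<le> fst q \<or> snd q \<le> fst p) \<longrightarrow>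
        (\<Sum>(x, y)\<in>S. y - x) < \<eta> \<longrightarrow>
        (\<forall>n. (\<Sum>(x, y)\<in>S. \<bar>F n y - F n x\<bar>) < \<epsilon>))"

end

theory Submission
  imports Defs
begin

text \<open>A continuous function with positive right lower derivate can attain its maximum over an
  interval only at the right endpoint, so it is increasing. Hence \<open>U - V\<close> is nondecreasing for a major
  function \<open>U\<close> and a minor function \<open>V\<close>, and the integral is additive and restricts to subintervals.
  It extends the Lebesgue integral, and conversely a nonnegative Laplace integrable function is Lebesgue
  integrable: its major functions are nondecreasing, and Fatou's lemma bounds the integral of the lower
  derivate of such a function by its total increment. As \<open>f n - g\<close> and \<open>F - g\<close> are nonnegative almost
  everywhere, the theorem is thereby reduced to nonnegative Lebesgue integrable functions, where the two
  implications are Scheffe's lemma and Vitali's convergence theorem.\<close>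

section \<open>Laplace transforms of increments\<close>

text \<open>Laplace integrability presupposes no measurability, and \<open>g\<close> and the
  \<open>f n\<close> may fail to be Lebesgue integrable. What turns out to be Lebesgue integrable
  are the differences \<open>f n - g\<close> and, under either side of the equivalence,
  \<open>F - g\<close>. Passage between the two integrals therefore goes through differences, and
  \<open>g\<close> is put back by additivity. A second obstacle is that the derivate inequalities
  are demanded at every point while the hypotheses hold almost everywhere. A function vanishing
  almost everywhere is Lebesgue integrable, hence Laplace integrable with integral 0, so adding one
  repairs a null set. The analytic core is the kernel: for \<open>s > 0\<close> the weight
  \<open>s^2 * t * exp (- s * t)\<close> is a probability density on the positive half-line, so a
  Laplace derivate is a limit of averages of difference quotients. For nondecreasing
  \<open>W\<close>, extended constantly, these averages integrate to at most
  \<open>W b - W a\<close> for each \<open>s > 0\<close> and not merely in the limit; this uniform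
  bound is what Fatou's lemma is fed with.\<close>

definition lap_op :: "(real \<Rightarrow> real) \<Rightarrow> real \<Rightarrow> real \<Rightarrow> real" where
  "lap_op \<phi> d s = s\<^sup>2 * integral {0..d} (\<lambda>t. exp (- s * t) * \<phi> t)"

text \<open>A real form of "the liminf is at least \<open>c\<close>", with tolerances in place of
  extended reals, so that truncation and addition amount to halving \<open>e\<close>.\<close>

definition lap_ge :: "(real \<Rightarrow> real) \<Rightarrow> real \<Rightarrow> real \<Rightarrow> bool" where
  "lap_ge \<phi> d c \<longleftrightarrow> (\<forall>e>0. \<forall>\<^sub>F s in at_top. c - e < lap_op \<phi> d s)"

lemma lap_integrable:
  "continuous_on {0..d} \<phi> \<Longrightarrow> (\<lambda>t. exp (- s * t) * \<phi> t) integrable_on {0..d}" for s d :: real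
  by (intro integrable_continuous_interval continuous_intros)

lemma lap_op_minus: "lap_op (\<lambda>t. - \<phi> t) d s = - lap_op \<phi> d s"
  by (simp add: lap_op_def)

lemma lap_op_add:
  assumes "continuous_on {0..d} \<phi>" "continuous_on {0..d} \<psi>"
  shows "lap_op (\<lambda>t. \<phi> t + \<psi> t) d s = lap_op \<phi> d s + lap_op \<psi> d s"
  unfolding lap_op_def
  by (simp only: distrib_left integral_add[OF lap_integrable lap_integrable] assms)

lemma lap_op_mono:
  assumes "continuous_on {0..d} \<phi>" "continuous_on {0..d} \<psi>" "\<And>t. t \<in> {0..d} \<Longrightarrow> \<phi> t \<le> \<psi> t"
  shows "lap_op \<phi> d s \<le> lap_op \<psi> d s"
  unfolding lap_op_def
  by (intro mult_left_mono integral_le lap_integrable assms) (auto intro: assms)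

lemma lap_op_cong: "(\<And>t. t \<in> {0..d} \<Longrightarrow> \<phi> t = \<psi> t) \<Longrightarrow> lap_op \<phi> d s = lap_op \<psi> d s"
  unfolding lap_op_def by (metis (mono_tags, lifting) integral_cong)

lemma tendsto_power_mult_exp_neg:
  fixes e :: real
  assumes "0 < e"
  shows "((\<lambda>s. s ^ k * exp (- s * e)) \<longlongrightarrow> 0) at_top"
proof -
  have "filterlim (\<lambda>s. s * e) at_top at_top"
    using assms by (intro filterlim_at_top_mult_tendsto_pos[OF tendsto_const] filterlim_ident) auto
  from tendsto_mult_right[OF filterlim_compose[OF tendsto_power_div_exp_0[of k] this], where c = "1 / e ^ k"]
  show ?thesis
    using assms by (simp add: power_mult_distrib exp_minus field_simps)
qed

text \<open>For \<open>s \<ge> 0\<close> the integral over \<open>{e..d}\<close> contributes at most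
  \<open>s^2 * exp (- s * e) * B * (d - e)\<close>, with \<open>B\<close> a bound for
  \<open>\<phi>\<close>, and this tends to 0. Derivates thus depend only on \<open>\<phi>\<close>
  near 0, and the window may be exchanged for that of a subinterval or for one common to all
  points.\<close>

lemma lap_op_truncate:
  assumes \<phi>: "continuous_on {0..d} \<phi>" and e: "0 < e" "e \<le> d"
  shows "((\<lambda>s. lap_op \<phi> d s - lap_op \<phi> e s) \<longlongrightarrow> 0) at_top"
proof -
  have "bounded (\<phi> ` {0..d})"
    using \<phi> compact_continuous_image compact_imp_bounded by blast
  then obtain B where B: "B > 0" "\<And>t. t \<in> {0..d} \<Longrightarrow> \<bar>\<phi> t\<bar> \<le> B"
    unfolding bounded_pos by auto
  have bound: "\<bar>lap_op \<phi> d s - lap_op \<phi> e s\<bar> \<le> s\<^sup>2 * (exp (- s * e) * B * (d - e))" if "s \<ge> 0" for s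
  proof -
    let ?I = "\<lambda>A. integral A (\<lambda>t. exp (- s * t) * \<phi> t)"
    have eq: "?I {0..e} + ?I {e..d} = ?I {0..d}"
      by (rule Henstock_Kurzweil_Integration.integral_combine[OF _ e(2) lap_integrable[OF \<phi>]]) (use e in simp)
    have "lap_op \<phi> d s - lap_op \<phi> e s = s\<^sup>2 * (?I {0..e} + ?I {e..d}) - s\<^sup>2 * ?I {0..e}"
      unfolding lap_op_def eq ..
    also have "\<dots> = s\<^sup>2 * ?I {e..d}"
      by (simp only: distrib_left add_diff_cancel_left')
    finally have "lap_op \<phi> d s - lap_op \<phi> e s = s\<^sup>2 * ?I {e..d}" .
    then have "\<bar>lap_op \<phi> d s - lap_op \<phi> e s\<bar> = s\<^sup>2 * norm (?I {e..d})"
      by (simp only: abs_mult abs_power2 real_norm_def)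
    also have "\<dots> \<le> s\<^sup>2 * (exp (- s * e) * B * (d - e))"
    proof (intro mult_left_mono integral_bound)
      show "continuous_on {e..d} (\<lambda>t. exp (- s * t) * \<phi> t)"
        using e by (intro continuous_intros continuous_on_subset[OF \<phi>]) auto
      show "norm (exp (- s * t) * \<phi> t) \<le> exp (- s * e) * B" if "t \<in> {e..d}" for t
        unfolding norm_mult using that B e \<open>s \<ge> 0\<close> by (intro mult_mono) (auto intro: mult_left_mono)
    qed (use e in auto)
    finally show ?thesis .
  qed
  have lim: "((\<lambda>s. s\<^sup>2 * (exp (- s * e) * B * (d - e))) \<longlongrightarrow> 0) at_top"
  proof -
    have "((\<lambda>s. s\<^sup>2 * exp (- s * e)) \<longlongrightarrow> 0) at_top"
      using tendsto_power_mult_exp_neg[OF e(1), of 2] .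
    from tendsto_mult_right[OF this, of "B * (d - e)"] show ?thesis
      by (simp add: mult_ac)
  qed
  show ?thesis
    using bound by (intro Lim_null_comparison[OF _ lim] eventually_at_top_linorderI[of 0]) (simp only: real_norm_def)
qed

lemma lap_op_linear_eq:
  assumes "0 < e" "0 < s"
  shows "lap_op (\<lambda>t. c * t) e s = c * (1 - exp (- s * e) * (1 + s * e))"
proof -
  \<comment> \<open>Integration by parts gives the antiderivative
    \<open>- c * exp (- s * t) * (t / s + 1 / s^2)\<close>.\<close>
  have "((\<lambda>t. exp (- s * t) * (c * t)) has_integral
     (- c * exp (- s * e) * (e / s + 1 / s\<^sup>2)) - (- c * exp (- s * 0) * (0 / s + 1 / s\<^sup>2))) {0..e}"
    using assms
    by (intro fundamental_theorem_of_calculus)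
       (auto intro!: derivative_eq_intros simp flip: has_real_derivative_iff_has_vector_derivative
         simp: field_simps power2_eq_square)
  then show ?thesis
    using assms unfolding lap_op_def by (auto dest!: integral_unique simp: field_simps power2_eq_square)
qed

lemma lap_op_linear: "((\<lambda>s. lap_op (\<lambda>t. c * t) e s) \<longlongrightarrow> c) at_top" if "0 < e"
proof -
  have "((\<lambda>s. c * (1 - (s ^ 0 * exp (- s * e) + s ^ 1 * exp (- s * e) * e))) \<longlongrightarrow> c * (1 - (0 + 0 * e))) at_top"
    by (intro tendsto_intros tendsto_power_mult_exp_neg that)
  then have "((\<lambda>s. c * (1 - exp (- s * e) * (1 + s * e))) \<longlongrightarrow> c) at_top"
    by (simp add: algebra_simps)
  then show ?thesis
    by (rule Lim_transform_eventually)
       (use that in \<open>auto simp: lap_op_linear_eq intro!: eventually_mono[OF eventually_gt_at_top[of 0]]\<close>)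
qed

lemma lap_ge_truncate:
  assumes "continuous_on {0..d} \<phi>" "0 < e" "e \<le> d"
  shows "lap_ge \<phi> d c \<longleftrightarrow> lap_ge \<phi> e c"
proof -
  have *: "\<forall>\<^sub>F s in at_top. \<bar>lap_op \<phi> d s - lap_op \<phi> e s\<bar> < \<eta>" if "\<eta> > 0" for \<eta>
    using tendstoD[OF lap_op_truncate[OF assms] that] by simp
  show ?thesis
    unfolding lap_ge_def
  proof (intro iffI allI impI)
    fix \<eta> :: real assume H: "\<forall>\<eta>>0. \<forall>\<^sub>F s in at_top. c - \<eta> < lap_op \<phi> d s" "\<eta> > 0"
    have "\<forall>\<^sub>F s in at_top. c - \<eta>/2 < lap_op \<phi> d s"
      "\<forall>\<^sub>F s in at_top. \<bar>lap_op \<phi> d s - lap_op \<phi> e s\<bar> < \<eta>/2"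
      by (rule H(1)[rule_format, OF half_gt_zero[OF H(2)]], rule *[OF half_gt_zero[OF H(2)]])
    then show "\<forall>\<^sub>F s in at_top. c - \<eta> < lap_op \<phi> e s"
      by eventually_elim linarith
  next
    fix \<eta> :: real assume H: "\<forall>\<eta>>0. \<forall>\<^sub>F s in at_top. c - \<eta> < lap_op \<phi> e s" "\<eta> > 0"
    have "\<forall>\<^sub>F s in at_top. c - \<eta>/2 < lap_op \<phi> e s"
      "\<forall>\<^sub>F s in at_top. \<bar>lap_op \<phi> d s - lap_op \<phi> e s\<bar> < \<eta>/2"
      by (rule H(1)[rule_format, OF half_gt_zero[OF H(2)]], rule *[OF half_gt_zero[OF H(2)]])
    then show "\<forall>\<^sub>F s in at_top. c - \<eta> < lap_op \<phi> d s"
      by eventually_elim linarith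
  qed
qed

lemma lap_ge_cong: "(\<And>t. t \<in> {0..d} \<Longrightarrow> \<phi> t = \<psi> t) \<Longrightarrow> lap_ge \<phi> d c = lap_ge \<psi> d c"
  unfolding lap_ge_def using lap_op_cong[of d \<phi> \<psi>] by simp

lemma lap_ge_weaken: "lap_ge \<phi> d c \<Longrightarrow> c' \<le> c \<Longrightarrow> lap_ge \<phi> d c'"
  unfolding lap_ge_def by (fastforce elim: eventually_mono)

lemma lap_ge_add:
  assumes "continuous_on {0..d} \<phi>" "continuous_on {0..d} \<psi>" and ge: "lap_ge \<phi> d c" "lap_ge \<psi> d c'"
  shows "lap_ge (\<lambda>t. \<phi> t + \<psi> t) d (c + c')"
  unfolding lap_ge_def
proof (intro allI impI)
  fix e :: real assume "e > 0"
  then have "\<forall>\<^sub>F s in at_top. c - e/2 < lap_op \<phi> d s" "\<forall>\<^sub>F s in at_top. c' - e/2 < lap_op \<psi> d s"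
    using ge unfolding lap_ge_def by auto
  then show "\<forall>\<^sub>F s in at_top. c + c' - e < lap_op (\<lambda>t. \<phi> t + \<psi> t) d s"
    by eventually_elim (simp add: lap_op_add assms)
qed

lemma lap_ge_slope:
  assumes \<phi>: "continuous_on {0..d} \<phi>" and "0 < e" "e \<le> d" and le: "\<And>t. t \<in> {0..e} \<Longrightarrow> c * t \<le> \<phi> t"
  shows "lap_ge \<phi> d c"
proof -
  have "lap_ge \<phi> e c"
    unfolding lap_ge_def
  proof (intro allI impI)
    fix \<eta> :: real assume "\<eta> > 0"
    then have "\<forall>\<^sub>F s in at_top. c - \<eta> < lap_op (\<lambda>t. c * t) e s"
      using order_tendstoD(1)[OF lap_op_linear[OF \<open>0 < e\<close>], of "c - \<eta>" c] by simp
    then show "\<forall>\<^sub>F s in at_top. c - \<eta> < lap_op \<phi> e s"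
    proof eventually_elim
      case (elim s)
      have "lap_op (\<lambda>t. c * t) e s \<le> lap_op \<phi> e s"
        using assms by (intro lap_op_mono continuous_intros continuous_on_subset[OF \<phi>]) auto
      with elim show ?case by simp
    qed
  qed
  then show ?thesis
    using lap_ge_truncate[of d \<phi> e] assms by simp
qed

text \<open>This excludes a maximum to the left of the endpoint: increments taken from a maximum are
  nonpositive, while a positive lower derivate would make some Laplace average positive.\<close>

lemma lap_ge_nonpos:
  assumes \<phi>: "continuous_on {0..d} \<phi>" and "0 < e" "e \<le> d"
    and le: "\<And>t. t \<in> {0..e} \<Longrightarrow> \<phi> t \<le> 0" and ge: "lap_ge \<phi> d c"
  shows "c \<le> 0"
proof (rule ccontr)
  assume "\<not> c \<le> 0"
  moreover have "lap_ge \<phi> e c"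
    using lap_ge_truncate[of d \<phi> e] assms by simp
  \<comment> \<open>The tolerance in \<open>lap_ge\<close> is taken to be \<open>c\<close> itself,
    so that \<open>c - e\<close> becomes 0.\<close>
  ultimately have "\<forall>\<^sub>F s in at_top. 0 < lap_op \<phi> e s"
    unfolding lap_ge_def by (elim allE[of _ c]) simp
  then obtain s where "0 < lap_op \<phi> e s"
    by (meson eventually_happens trivial_limit_at_top_linorder)
  moreover have "lap_op \<phi> e s \<le> lap_op (\<lambda>t. 0) e s"
    using assms by (intro lap_op_mono continuous_intros continuous_on_subset[OF \<phi>]) auto
  ultimately show False by (simp add: lap_op_def)
qed

section \<open>Major and minor functions through real inequalities\<close>

lemma ereal_le_Liminf_iff:
  "ereal c \<le> Liminf F (\<lambda>s. ereal (h s)) \<longleftrightarrow> (\<forall>e>0. \<forall>\<^sub>F s in F. c - e < h s)"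
proof
  assume "ereal c \<le> Liminf F (\<lambda>s. ereal (h s))"
  then show "\<forall>e>0. \<forall>\<^sub>F s in F. c - e < h s"
    unfolding le_Liminf_iff by (force dest: spec[of _ "ereal (c - _)"])
next
  assume H: "\<forall>e>0. \<forall>\<^sub>F s in F. c - e < h s"
  show "ereal c \<le> Liminf F (\<lambda>s. ereal (h s))"
    unfolding le_Liminf_iff
  proof (intro allI impI)
    fix y assume "y < ereal c"
    then obtain r where r: "y < ereal r" "r < c"
      by (metis ereal_dense2 ereal_less_eq(3) less_ereal.simps(1))
    with H[rule_format, of "c - r"] have "\<forall>\<^sub>F s in F. r < h s" by simp
    then show "\<forall>\<^sub>F s in F. y < ereal (h s)"
      by eventually_elim (use r in \<open>meson less_ereal.simps(1) less_trans\<close>)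
  qed
qed

text \<open>The infimum of the one or two liminfs is at least \<open>f x\<close> iff each of them
  is, and a finite bound can be tested with real tolerances. Using the increment
  \<open>U x - U (x - t)\<close> absorbs the minus sign of the left derivate, so both sides take the
  same form.\<close>

lemma laplace_major_iff:
  "laplace_major f a b U \<longleftrightarrow> continuous_on {a..b} U \<and>
     (\<forall>x\<in>{a..b}. (x < b \<longrightarrow> lap_ge (\<lambda>t. U (x + t) - U x) (b - x) (f x)) \<and>
                 (a < x \<longrightarrow> lap_ge (\<lambda>t. U x - U (x - t)) (x - a) (f x)))"
proof -
  have right: "lap_right U b x = lap_op (\<lambda>t. U (x + t) - U x) (b - x)" for x
    by (simp add: lap_right_def lap_op_def fun_eq_iff)
  have left: "lap_left U a x = lap_op (\<lambda>t. U x - U (x - t)) (x - a)" for x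
  proof
    fix s
    have "lap_left U a x s = - lap_op (\<lambda>t. U (x - t) - U x) (x - a) s"
      by (simp add: lap_left_def lap_op_def)
    also have "\<dots> = lap_op (\<lambda>t. U x - U (x - t)) (x - a) s"
      by (subst lap_op_minus[symmetric]) (simp add: minus_diff_eq)
    finally show "lap_left U a x s = lap_op (\<lambda>t. U x - U (x - t)) (x - a) s" .
  qed
  have "(lower_LD U a b x \<ge> ereal (f x) \<and> lower_LD U a b x > - \<infinity>) \<longleftrightarrow> lower_LD U a b x \<ge> ereal (f x)" for x
    by (cases "lower_LD U a b x") auto
  then show ?thesis
    unfolding laplace_major_def
    by (auto simp: lower_LD_def le_Inf_iff right left ereal_le_Liminf_iff lap_ge_def)
qed

text \<open>Negation turns limsup into liminf and the larger upper derivate into the smaller lower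
  one. Restriction, addition and comparison of minor functions are inherited from major functions in
  this way.\<close>

lemma laplace_minor_iff: "laplace_minor f a b V \<longleftrightarrow> laplace_major (\<lambda>x. - f x) a b (\<lambda>x. - V x)"
proof -
  have neg: "Liminf at_top (\<lambda>s. ereal (- h s)) = - Limsup at_top (\<lambda>s. ereal (h s))" for h :: "real \<Rightarrow> real"
    using ereal_Liminf_uminus[of at_top "\<lambda>s. ereal (h s)"] by simp
  have right: "lap_right (\<lambda>x. - V x) b x s = - lap_right V b x s" for x s
  proof -
    have "lap_right (\<lambda>x. - V x) b x s = lap_op (\<lambda>t. - (V (x + t) - V x)) (b - x) s"
      by (simp add: lap_right_def lap_op_def)
    then show ?thesis
      unfolding lap_op_minus by (simp add: lap_right_def lap_op_def)
  qed
  have left: "lap_left (\<lambda>x. - V x) a x s = - lap_left V a x s" for x s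
  proof -
    have "lap_left (\<lambda>x. - V x) a x s = - lap_op (\<lambda>t. - (V (x - t) - V x)) (x - a) s"
      by (simp add: lap_left_def lap_op_def)
    then show ?thesis
      unfolding lap_op_minus by (simp add: lap_left_def lap_op_def)
  qed
  have "lower_LD (\<lambda>x. - V x) a b x = - upper_LD V a b x" for x
    unfolding lower_LD_def upper_LD_def left right neg ereal_Inf_uminus_image_eq[symmetric]
    by (rule arg_cong[where f = Inf]) auto
  then show ?thesis
    unfolding laplace_minor_def laplace_major_def
    by (auto simp: continuous_on_minus dest: continuous_on_minus simp flip: uminus_ereal.simps(1)
       simp: ereal_minus_le_minus ereal_uminus_less_reorder ereal_less_uminus_reorder)
qed

section \<open>Basic properties of the Laplace integral\<close>

lemma continuous_on_increment:
  fixes U :: "real \<Rightarrow> real"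
  assumes "continuous_on {a..b} U" "x \<in> {a..b}"
  shows "continuous_on {0..b - x} (\<lambda>t. U (x + t) - U x)"
    and "continuous_on {0..x - a} (\<lambda>t. U x - U (x - t))"
  using assms(2) by (auto intro!: continuous_intros continuous_on_compose2[OF assms(1)])

text \<open>Comparison with a line of slope \<open>f x\<close> bounds both one-sided derivates: take
  \<open>y = x\<close> on the right and \<open>z = x\<close> on the left. The major functions built
  explicitly below, linear functions and integrals of layer indicators, are recognised by this
  criterion.\<close>

lemma laplace_majorI_slope:
  assumes U: "continuous_on {a..b} U"
    and slope: "\<And>x. x \<in> {a..b} \<Longrightarrow>
      \<exists>e>0. \<forall>y z. a \<le> y \<and> y \<le> z \<and> z \<le> b \<and> x - e < y \<and> z < x + e \<longrightarrow> f x * (z - y) \<le> U z - U y"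
  shows "laplace_major f a b U"
  unfolding laplace_major_iff
proof (intro conjI ballI impI)
  fix x assume x: "x \<in> {a..b}"
  then obtain e where e: "e > 0"
    "\<And>y z. a \<le> y \<Longrightarrow> y \<le> z \<Longrightarrow> z \<le> b \<Longrightarrow> x - e < y \<Longrightarrow> z < x + e \<Longrightarrow> f x * (z - y) \<le> U z - U y"
    using slope by metis
  show "lap_ge (\<lambda>t. U (x + t) - U x) (b - x) (f x)" if "x < b"
  proof (rule lap_ge_slope[OF continuous_on_increment(1)[OF U x]])
    show "f x * t \<le> U (x + t) - U x" if "t \<in> {0..min (b - x) (e / 2)}" for t
      using e(2)[of x "x + t"] that x \<open>e > 0\<close> by auto
  qed (use that e in auto)
  show "lap_ge (\<lambda>t. U x - U (x - t)) (x - a) (f x)" if "a < x"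
  proof (rule lap_ge_slope[OF continuous_on_increment(2)[OF U x]])
    show "f x * t \<le> U x - U (x - t)" if "t \<in> {0..min (x - a) (e / 2)}" for t
      using e(2)[of "x - t" x] that x \<open>e > 0\<close> by auto
  qed (use that e in auto)
qed (rule U)

lemma laplace_major_add:
  assumes U: "laplace_major f a b U" and W: "laplace_major g a b W"
  shows "laplace_major (\<lambda>x. f x + g x) a b (\<lambda>x. U x + W x)"
  unfolding laplace_major_iff
proof (intro conjI ballI impI)
  have c: "continuous_on {a..b} U" "continuous_on {a..b} W"
    using U W by (auto simp: laplace_major_iff)
  show "continuous_on {a..b} (\<lambda>x. U x + W x)"
    by (intro continuous_intros c)
  fix x assume x: "x \<in> {a..b}"
  show "lap_ge (\<lambda>t. U (x + t) + W (x + t) - (U x + W x)) (b - x) (f x + g x)" if "x < b"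
  proof -
    have "lap_ge (\<lambda>t. (U (x + t) - U x) + (W (x + t) - W x)) (b - x) (f x + g x)"
      using U W x that by (intro lap_ge_add continuous_on_increment c) (auto simp: laplace_major_iff)
    then show ?thesis by (simp add: algebra_simps)
  qed
  show "lap_ge (\<lambda>t. U x + W x - (U (x - t) + W (x - t))) (x - a) (f x + g x)" if "a < x"
  proof -
    have "lap_ge (\<lambda>t. (U x - U (x - t)) + (W x - W (x - t))) (x - a) (f x + g x)"
      using U W x that by (intro lap_ge_add continuous_on_increment c) (auto simp: laplace_major_iff)
    then show ?thesis by (simp add: algebra_simps)
  qed
qed

lemma laplace_major_weaken:
  "laplace_major f a b U \<Longrightarrow> (\<And>x. x \<in> {a..b} \<Longrightarrow> g x \<le> f x) \<Longrightarrow> laplace_major g a b U"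
  unfolding laplace_major_iff by (meson lap_ge_weaken)

text \<open>At interior points only the window shrinks, which truncation permits; at each new
  endpoint one of the two conditions disappears.\<close>

lemma laplace_major_subinterval:
  assumes U: "laplace_major f a b U" and cd: "a \<le> c" "d \<le> b"
  shows "laplace_major f c d U"
  unfolding laplace_major_iff
proof (intro conjI ballI impI)
  have c: "continuous_on {a..b} U"
    using U by (auto simp: laplace_major_iff)
  then show "continuous_on {c..d} U"
    by (rule continuous_on_subset) (use cd in auto)
  fix x assume x: "x \<in> {c..d}"
  then have xab: "x \<in> {a..b}" using cd by auto
  show "lap_ge (\<lambda>t. U (x + t) - U x) (d - x) (f x)" if "x < d"
  proof -
    have "lap_ge (\<lambda>t. U (x + t) - U x) (b - x) (f x)"
      using U xab that cd unfolding laplace_major_iff by auto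
    then show ?thesis
      using lap_ge_truncate[OF continuous_on_increment(1)[OF c xab], of "d - x" "f x"] that cd by simp
  qed
  show "lap_ge (\<lambda>t. U x - U (x - t)) (x - c) (f x)" if "c < x"
  proof -
    have "lap_ge (\<lambda>t. U x - U (x - t)) (x - a) (f x)"
      using U xab that cd unfolding laplace_major_iff by auto
    then show ?thesis
      using lap_ge_truncate[OF continuous_on_increment(2)[OF c xab], of "x - c" "f x"] that cd by simp
  qed
qed

lemma laplace_minor_subinterval:
  "laplace_minor f a b V \<Longrightarrow> a \<le> c \<Longrightarrow> d \<le> b \<Longrightarrow> laplace_minor f c d V"
  unfolding laplace_minor_iff by (rule laplace_major_subinterval)

text \<open>After adding a small positive slope, the right derivate is positive everywhere, so the
  maximum over the interval can only be attained at the right endpoint.\<close>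

lemma laplace_major_zero_le:
  assumes W: "laplace_major (\<lambda>_. 0) a b W" and "a \<le> b"
  shows "W a \<le> W b"
proof -
  have le: "W a + e * a \<le> W b + e * b" if "e > 0" for e
  proof -
    have c: "continuous_on {a..b} (\<lambda>x. W x + e * x)"
      using W unfolding laplace_major_iff by (auto intro!: continuous_intros)
    then obtain x where x: "x \<in> {a..b}" "\<And>y. y \<in> {a..b} \<Longrightarrow> W y + e * y \<le> W x + e * x"
      using continuous_attains_sup[OF compact_Icc _ c] \<open>a \<le> b\<close> by auto
    have "laplace_major (\<lambda>_. e) a b (\<lambda>x. e * x)"
      by (rule laplace_majorI_slope) (auto intro!: continuous_intros exI[of _ 1] simp: algebra_simps)
    from laplace_major_add[OF W this] have m: "laplace_major (\<lambda>_. e) a b (\<lambda>x. W x + e * x)"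
      by simp
    have "x = b"
    proof (rule ccontr)
      assume "x \<noteq> b"
      then have "x < b" using x by auto
      then have "lap_ge (\<lambda>t. W (x + t) + e * (x + t) - (W x + e * x)) (b - x) e"
        using m x unfolding laplace_major_iff by blast
      then have "e \<le> 0"
        by (rule lap_ge_nonpos[OF continuous_on_increment(1)[OF c x(1)], of "b - x", rotated -1])
           (use \<open>x < b\<close> x in auto)
      with that show False by simp
    qed
    with x \<open>a \<le> b\<close> show ?thesis by auto
  qed
  show ?thesis
  proof (rule field_le_epsilon)
    fix e :: real assume "e > 0"
    show "W a \<le> W b + e"
    proof (cases "a = b")
      case False
      with \<open>a \<le> b\<close> have "0 < b - a" by simp
      then have "W a + e / (b - a) * a \<le> W b + e / (b - a) * b"
        using le[of "e / (b - a)"] \<open>e > 0\<close> by simp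
      moreover have "e / (b - a) * b - e / (b - a) * a = e"
        unfolding right_diff_distrib[symmetric] using \<open>0 < b - a\<close> by simp
      ultimately show ?thesis by linarith
    qed (use \<open>e > 0\<close> in auto)
  qed
qed

lemma laplace_major_minus_minor:
  "laplace_major f a b U \<Longrightarrow> laplace_minor f a b V \<Longrightarrow> laplace_major (\<lambda>_. 0) a b (\<lambda>x. U x - V x)"
  using laplace_major_add[of f a b U "\<lambda>x. - f x" "\<lambda>x. - V x"] by (simp add: laplace_minor_iff)

lemma laplace_minor_le_major:
  assumes "laplace_major f a b U" "laplace_minor f a b V" "a \<le> x" "x \<le> y" "y \<le> b"
  shows "V y - V x \<le> U y - U x"
  using laplace_major_zero_le[OF laplace_major_subinterval[OF laplace_major_minus_minor[OF assms(1,2)] assms(3,5)] assms(4)]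
  by simp

section \<open>The integral by approximating pairs\<close>

text \<open>For \<open>a \<le> b\<close> every minor increment lies below every major one, so pairs
  closing in on \<open>I\<close> from both sides pin down the upper and lower integrals. Sums then
  need only two tolerances \<open>e / 2\<close>, and negation exchanges the members of a
  pair.\<close>

definition has_laplace_integral :: "(real \<Rightarrow> real) \<Rightarrow> real \<Rightarrow> real \<Rightarrow> real \<Rightarrow> bool" where
  "has_laplace_integral f a b I \<longleftrightarrow> (\<forall>e>0. \<exists>U V. laplace_major f a b U \<and> laplace_minor f a b V \<and>
     U b - U a < I + e \<and> I - e < V b - V a)"

lemma laplace_lower_le_upper: "a \<le> b \<Longrightarrow> laplace_lower f a b \<le> laplace_upper f a b"
  unfolding laplace_lower_def laplace_upper_def
  by (intro SUP_least INF_greatest) (auto intro: laplace_minor_le_major)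

lemma laplace_upper_le: "laplace_major f a b U \<Longrightarrow> laplace_upper f a b \<le> ereal (U b - U a)"
  unfolding laplace_upper_def by (rule INF_lower) simp

lemma laplace_lower_ge: "laplace_minor f a b V \<Longrightarrow> ereal (V b - V a) \<le> laplace_lower f a b"
  unfolding laplace_lower_def by (rule SUP_upper) simp

lemma has_laplace_integral_iff:
  assumes "a \<le> b"
  shows "has_laplace_integral f a b I \<longleftrightarrow> laplace_integrable f a b \<and> laplace_integral f a b = I"
proof
  assume H: "has_laplace_integral f a b I"
  have "laplace_upper f a b \<le> ereal I"
  proof (rule ereal_le_epsilon2)
    fix e :: real assume "e > 0"
    then obtain U where "laplace_major f a b U" "U b - U a < I + e"
      using H unfolding has_laplace_integral_def by meson
    then show "laplace_upper f a b \<le> ereal I + ereal e"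
      using order_trans[OF laplace_upper_le, of f a b U "ereal (I + e)"] by simp
  qed
  moreover have "ereal I \<le> laplace_lower f a b"
  proof (rule ereal_le_epsilon2)
    fix e :: real assume "e > 0"
    then obtain V where "laplace_minor f a b V" "I - e < V b - V a"
      using H unfolding has_laplace_integral_def by meson
    then have "ereal (I - e) \<le> laplace_lower f a b"
      using order_trans[OF _ laplace_lower_ge, of "ereal (I - e)" V b a f] by simp
    then show "ereal I \<le> laplace_lower f a b + ereal e"
      by (cases "laplace_lower f a b") auto
  qed
  moreover note laplace_lower_le_upper[OF assms, of f]
  ultimately have "laplace_upper f a b = ereal I" "laplace_lower f a b = ereal I"
    by order+
  then show "laplace_integrable f a b \<and> laplace_integral f a b = I"
    by (simp add: laplace_integrable_def laplace_integral_def)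
next
  assume "laplace_integrable f a b \<and> laplace_integral f a b = I"
  then have I: "laplace_upper f a b = ereal I" "laplace_lower f a b = ereal I"
    unfolding laplace_integrable_def laplace_integral_def by auto
  show "has_laplace_integral f a b I"
    unfolding has_laplace_integral_def
  proof (intro allI impI)
    fix e :: real assume "e > 0"
    then have "laplace_upper f a b < ereal (I + e)" "ereal (I - e) < laplace_lower f a b"
      using I by auto
    then show "\<exists>U V. laplace_major f a b U \<and> laplace_minor f a b V \<and>
        U b - U a < I + e \<and> I - e < V b - V a"
      unfolding laplace_upper_def laplace_lower_def INF_less_iff less_SUP_iff by auto
  qed
qed

text \<open>Since \<open>U - V\<close> is nondecreasing, a pair whose increments differ by less than
  \<open>e\<close> over \<open>[a,b]\<close> differs by no more over \<open>[a,x]\<close>.\<close>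

lemma laplace_integrable_subinterval:
  assumes f: "laplace_integrable f a b" and x: "a \<le> x" "x \<le> b"
  shows "laplace_integrable f a x"
proof -
  have H: "has_laplace_integral f a b (laplace_integral f a b)"
    using f x has_laplace_integral_iff[of a b] by simp
  have gap: "\<exists>U V. laplace_major f a x U \<and> laplace_minor f a x V \<and> U x - U a \<le> (V x - V a) + e"
    if e: "e > 0" for e
  proof -
    obtain U V where UV: "laplace_major f a b U" "laplace_minor f a b V"
      "U b - U a < laplace_integral f a b + e / 2" "laplace_integral f a b - e / 2 < V b - V a"
      using H[unfolded has_laplace_integral_def, rule_format, OF half_gt_zero[OF e]] by blast
    have "V b - V x \<le> U b - U x"
      using laplace_minor_le_major[OF UV(1,2)] x by simp
    with UV x show ?thesis
      by (intro exI[of _ U] exI[of _ V] conjI laplace_major_subinterval[OF UV(1)]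
          laplace_minor_subinterval[OF UV(2)]) auto
  qed
  \<comment> \<open>A single pair bounds the upper integral from above and the lower one from below;
    once the two agree, their value is finite.\<close>
  obtain U V where UV: "laplace_major f a x U" "laplace_minor f a x V"
    using gap[of 1] by auto
  have "laplace_upper f a x \<le> laplace_lower f a x"
  proof (rule ereal_le_epsilon2)
    fix e :: real assume "e > 0"
    then obtain U V where "laplace_major f a x U" "laplace_minor f a x V" "U x - U a \<le> (V x - V a) + e"
      using gap by blast
    then have "laplace_upper f a x \<le> ereal (V x - V a) + ereal e"
      using order_trans[OF laplace_upper_le, of f a x U "ereal (V x - V a + e)"] by simp
    also have "\<dots> \<le> laplace_lower f a x + ereal e"
      by (intro add_right_mono laplace_lower_ge) fact
    finally show "laplace_upper f a x \<le> laplace_lower f a x + ereal e" .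
  qed
  then show ?thesis
    using laplace_lower_le_upper[OF x(1), of f] laplace_upper_le[OF UV(1)] laplace_lower_ge[OF UV(2)]
    unfolding laplace_integrable_def
    by (cases "laplace_upper f a x"; cases "laplace_lower f a x") auto
qed

lemma has_laplace_integral_minus:
  assumes "has_laplace_integral f a b I"
  shows "has_laplace_integral (\<lambda>x. - f x) a b (- I)"
  unfolding has_laplace_integral_def
proof (intro allI impI)
  fix e :: real assume "e > 0"
  then obtain U V where "laplace_major f a b U" "laplace_minor f a b V"
    "U b - U a < I + e" "I - e < V b - V a"
    using assms unfolding has_laplace_integral_def by meson
  then show "\<exists>U V. laplace_major (\<lambda>x. - f x) a b U \<and> laplace_minor (\<lambda>x. - f x) a b V \<and>
      U b - U a < - I + e \<and> - I - e < V b - V a"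
    by (intro exI[of _ "\<lambda>x. - V x"] exI[of _ "\<lambda>x. - U x"]) (auto simp: laplace_minor_iff)
qed

lemma has_laplace_integral_add:
  assumes f: "has_laplace_integral f a b I" and g: "has_laplace_integral g a b J"
  shows "has_laplace_integral (\<lambda>x. f x + g x) a b (I + J)"
  unfolding has_laplace_integral_def
proof (intro allI impI)
  fix e :: real assume "e > 0"
  then have e: "e / 2 > 0" by simp
  obtain U V where 1: "laplace_major f a b U" "laplace_minor f a b V"
    "U b - U a < I + e / 2" "I - e / 2 < V b - V a"
    using f e unfolding has_laplace_integral_def by meson
  obtain U' V' where 2: "laplace_major g a b U'" "laplace_minor g a b V'"
    "U' b - U' a < J + e / 2" "J - e / 2 < V' b - V' a"
    using g e unfolding has_laplace_integral_def by meson
  have "laplace_minor (\<lambda>x. f x + g x) a b (\<lambda>x. V x + V' x)"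
    using laplace_major_add[OF 1(2)[unfolded laplace_minor_iff] 2(2)[unfolded laplace_minor_iff]]
    by (simp add: laplace_minor_iff add.commute)
  with laplace_major_add[OF 1(1) 2(1)] 1 2
  show "\<exists>U V. laplace_major (\<lambda>x. f x + g x) a b U \<and> laplace_minor (\<lambda>x. f x + g x) a b V \<and>
      U b - U a < I + J + e \<and> I + J - e < V b - V a"
    by (intro exI[of _ "\<lambda>x. U x + U' x"] exI[of _ "\<lambda>x. V x + V' x"]) auto
qed

lemma has_laplace_integral_diff:
  assumes "has_laplace_integral f a b I" "has_laplace_integral g a b J"
  shows "has_laplace_integral (\<lambda>x. f x - g x) a b (I - J)"
  using has_laplace_integral_add[OF assms(1) has_laplace_integral_minus[OF assms(2)]] by simp

section \<open>Lebesgue integrable functions are Laplace integrable\<close>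

lemma integrable_on_min_const:
  fixes h :: "real \<Rightarrow> real"
  assumes "h integrable_on {a..b}" "\<And>x. x \<in> {a..b} \<Longrightarrow> 0 \<le> h x"
  shows "(\<lambda>x. min (h x) c) integrable_on {a..b}"
proof -
  have "h absolutely_integrable_on {a..b}" "(\<lambda>_. c) absolutely_integrable_on {a..b}"
    using nonnegative_absolutely_integrable_1[OF assms] absolutely_integrable_on_const[of "{a..b}" c] by auto
  from absolutely_integrable_min_1[OF this] show ?thesis
    using set_lebesgue_integral_eq_integral(1) by blast
qed

lemma integral_min_const_tendsto:
  fixes h :: "real \<Rightarrow> real"
  assumes h: "h integrable_on {a..b}" "\<And>x. x \<in> {a..b} \<Longrightarrow> 0 \<le> h x"
  shows "(\<lambda>n. integral {a..b} (\<lambda>x. min (h x) (real n))) \<longlonglongrightarrow> integral {a..b} h"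
proof (rule dominated_convergence(2)[OF integrable_on_min_const[OF h] h(1)])
  fix x assume x: "x \<in> {a..b}"
  show "norm (min (h x) (real n)) \<le> h x" for n
    using h(2)[OF x] by simp
  obtain N where N: "h x \<le> real N"
    using real_arch_simple by blast
  show "(\<lambda>n. min (h x) (real n)) \<longlonglongrightarrow> h x"
    by (rule tendsto_eventually, rule eventually_sequentiallyI[of N]) (use N in auto)
qed

text \<open>The set where \<open>h\<close> lies in \<open>[k\<delta>, (k+1)\<delta>)\<close> is covered by an open set \<open>V k\<close> of nearly the same
  measure, and \<open>U\<close> is the indefinite integral of \<open>\<Sum>k. (k+1)\<delta> 1\<^bsub>V k\<^esub>\<close>. That series may be
  infinite at some points, so it is integrated termwise.\<close>

lemma integrable_nonneg_laplace_major:
  assumes h: "h integrable_on {a..b}" and pos: "\<And>x. x \<in> {a..b} \<Longrightarrow> 0 \<le> h x" and "a \<le> b" "e > 0"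
  obtains U where "laplace_major h a b U" "U b - U a < integral {a..b} h + e"
proof -
  \<comment> \<open>Rounding \<open>h\<close> up to a multiple of \<open>\<delta>\<close> costs at
    most \<open>\<delta> * (b - a) < e / 2\<close>. The summand 1 in the denominator covers the case
    \<open>a = b\<close>.\<close>
  define \<delta> where "\<delta> = e / (4 * (b - a + 1))"
  have "\<delta> > 0" "\<delta> * (b - a + 1) = e / 4"
    using \<open>a \<le> b\<close> \<open>e > 0\<close> by (auto simp: \<delta>_def divide_simps)
  then have \<delta>: "\<delta> > 0" "\<delta> * (b - a) < e / 2"
    using \<open>e > 0\<close> by (auto simp: algebra_simps)
  define c where "c k = (real k + 1) * \<delta>" for k :: nat
  have c: "c k > 0" for k
    using \<delta> by (simp add: c_def)
  define E where "E k = {x \<in> {a..b}. real k * \<delta> \<le> h x \<and> h x < c k}" for k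
  have E: "E k \<in> sets lebesgue" for k
  proof -
    have [measurable]: "h \<in> borel_measurable (lebesgue_on {a..b})"
      by (rule integrable_imp_measurable[OF h])
    have "{x \<in> space (lebesgue_on {a..b}). real k * \<delta> \<le> h x \<and> h x < c k} \<in> sets (lebesgue_on {a..b})"
      by measurable
    then show ?thesis
      by (simp add: E_def sets_restrict_space_iff)
  qed
  \<comment> \<open>Dividing by \<open>c k\<close> compensates the weight of layer \<open>k\<close>,
    so all excess measures together cost at most \<open>e / 2\<close> by a geometric series.\<close>
  define \<epsilon> where "\<epsilon> k = e / 2 * (1 / 2) ^ Suc k / c k" for k
  have \<epsilon>: "\<epsilon> k > 0" for k
    using c[of k] \<open>e > 0\<close> by (simp add: \<epsilon>_def)
  have "\<exists>V. open V \<and> E k \<subseteq> V \<and> V - E k \<in> lmeasurable \<and> emeasure lebesgue (V - E k) < ennreal (\<epsilon> k)" for k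
    using sets_lebesgue_outer_open[OF E \<epsilon>] by metis
  then obtain V where V: "\<And>k. open (V k)" "\<And>k. E k \<subseteq> V k" "\<And>k. V k - E k \<in> lmeasurable"
    "\<And>k. emeasure lebesgue (V k - E k) < ennreal (\<epsilon> k)"
    by metis
  have int_ind: "indicat_real A integrable_on {x..y}" if "A \<in> sets lebesgue" for A and x y :: real
    unfolding integrable_on_indicator
    using fmeasurable_Int_fmeasurable[of "{x..y}" lebesgue A] that by (simp add: Int_commute)
  have V_sets: "V k \<in> sets lebesgue" for k
    using V(1) by auto
  define G where "G k x = integral {a..x} (indicat_real (V k))" for k x
  have G_diff: "G k z - G k y = integral {y..z} (indicat_real (V k))" if "a \<le> y" "y \<le> z" for k y z
    using Henstock_Kurzweil_Integration.integral_combine[OF that int_ind[OF V_sets[of k]]]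
    by (simp add: G_def)
  have G_mono: "G k y \<le> G k z" if "a \<le> y" "y \<le> z" for k y z
  proof -
    have "0 \<le> integral {y..z} (indicat_real (V k))"
      by (rule Henstock_Kurzweil_Integration.integral_nonneg[OF int_ind[OF V_sets]]) auto
    then show ?thesis using G_diff[OF that, of k] by linarith
  qed
  have G_a: "G k a = 0" for k
    by (simp add: G_def)
  define m where "m k = integral {a..b} (indicat_real (E k))" for k
  have G_b: "G k b \<le> m k + \<epsilon> k" for k
  proof -
    have VE: "V k - E k \<in> sets lebesgue"
      using V(3)[of k] by auto
    have "integral {a..b} (indicat_real (V k)) \<le> integral {a..b} (\<lambda>x. indicat_real (E k) x + indicat_real (V k - E k) x)"
      by (intro integral_le integrable_add int_ind V_sets E VE) (auto simp: indicator_def)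
    also have "\<dots> = m k + integral {a..b} (indicat_real (V k - E k))"
      unfolding m_def by (intro integral_add int_ind E VE)
    also have "integral {a..b} (indicat_real (V k - E k)) \<le> integral UNIV (indicat_real (V k - E k))"
    proof (intro integral_subset_le int_ind VE)
      show "indicat_real (V k - E k) integrable_on UNIV"
        unfolding integrable_on_indicator using V(3)[of k] by simp
    qed auto
    also have "\<dots> = measure lebesgue (V k - E k)"
      using lmeasure_integral_UNIV[OF V(3)[of k]] by simp
    also have "\<dots> \<le> \<epsilon> k"
      using V(3,4)[of k] \<epsilon>[of k] by (simp add: emeasure_eq_measure2 ennreal_less_iff less_imp_le)
    finally show ?thesis by (simp add: G_def)
  qed
  have sum_m: "(\<Sum>k<n. c k * m k) \<le> integral {a..b} h + \<delta> * (b - a)" for n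
  proof -
    have "(\<Sum>k<n. c k * m k) = integral {a..b} (\<lambda>x. \<Sum>k<n. c k * indicat_real (E k) x)"
      unfolding m_def by (subst integral_sum) (auto intro!: integrable_on_mult_right int_ind E)
    also have "\<dots> \<le> integral {a..b} (\<lambda>x. h x + \<delta>)"
    proof (intro integral_le integrable_sum integrable_on_mult_right int_ind E integrable_add h integrable_const_ivl)
      fix x assume x: "x \<in> {a..b}"
      \<comment> \<open>The layers are disjoint: \<open>x\<close> can lie only in layer
        \<open>j\<close>, and if it does, the sum consists of the single term
        \<open>c j \<le> h x + \<delta>\<close>.\<close>
      define j where "j = nat \<lfloor>h x / \<delta>\<rfloor>"
      have "c k * indicat_real (E k) x \<le> (if k = j then h x + \<delta> else 0)" for k
      proof (cases "x \<in> E k")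
        case True
        then have "real k \<le> h x / \<delta>" "h x / \<delta> < real k + 1"
          using \<delta> by (auto simp: E_def c_def field_simps)
        then have "\<lfloor>h x / \<delta>\<rfloor> = int k"
          by linarith
        then have "k = j"
          by (simp add: j_def)
        with True show ?thesis
          by (auto simp: E_def c_def algebra_simps)
      qed (use pos[OF x] \<delta> in auto)
      then have "(\<Sum>k<n. c k * indicat_real (E k) x) \<le> (\<Sum>k<n. if k = j then h x + \<delta> else 0)"
        by (intro sum_mono) auto
      also have "\<dots> \<le> h x + \<delta>"
        using pos[OF x] \<delta> by simp
      finally show "(\<Sum>k<n. c k * indicat_real (E k) x) \<le> h x + \<delta>" .
    qed auto
    also have "\<dots> = integral {a..b} h + \<delta> * (b - a)"
      using \<open>a \<le> b\<close> by (subst integral_add) (auto intro: h simp: mult.commute)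
    finally show ?thesis .
  qed
  have sum_\<epsilon>: "(\<Sum>k<n. c k * \<epsilon> k) \<le> e / 2" for n
  proof -
    have "(\<Sum>k<n. c k * \<epsilon> k) = e / 2 * (\<Sum>k<n. (1 / 2) ^ Suc k)"
      unfolding sum_distrib_left using c by (intro sum.cong) (auto simp: \<epsilon>_def less_imp_neq[THEN not_sym])
    also have "(\<Sum>k<n. (1 / 2) ^ Suc k) \<le> (1 :: real)"
      using sum_le_suminf[OF sums_summable[OF power_half_series], of "{..<n}"] sums_unique[OF power_half_series]
      by simp
    finally show ?thesis using \<open>e > 0\<close> by simp
  qed
  have sum_G: "(\<Sum>k<n. c k * G k b) \<le> integral {a..b} h + \<delta> * (b - a) + e / 2" for n
  proof -
    have "(\<Sum>k<n. c k * G k b) \<le> (\<Sum>k<n. c k * m k + c k * \<epsilon> k)"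
      using G_b c by (intro sum_mono) (simp add: less_imp_le mult_left_mono flip: distrib_left)
    then show ?thesis
      using sum_m[of n] sum_\<epsilon>[of n] by (simp add: sum.distrib)
  qed
  have cG_nonneg: "0 \<le> c k * G k x" if "a \<le> x" for k x
    using G_mono[of a x k] that c[of k] G_a[of k] by simp
  have summable_b: "summable (\<lambda>k. c k * G k b)"
    using sum_G[of "Suc _"] cG_nonneg[OF \<open>a \<le> b\<close>]
    by (intro bounded_imp_summable) (auto simp: lessThan_Suc_atMost)
  have cG_le: "norm (c k * G k x) \<le> c k * G k b" if "x \<in> {a..b}" for k x
    using cG_nonneg[of x k] G_mono[of x b k] that c[of k] by (auto simp: mult_left_mono)
  have summable: "summable (\<lambda>k. c k * G k x)" if "x \<in> {a..b}" for x
    using summable_comparison_test'[OF summable_b, of 0 "\<lambda>k. c k * G k x"] cG_le[OF that] by blast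
  define U where "U x = (\<Sum>k. c k * G k x)" for x
  \<comment> \<open>Each \<open>G k\<close> increases from 0, so the numbers
    \<open>c k * G k b\<close> serve as majorants for the Weierstrass test.\<close>
  have U_cont: "continuous_on {a..b} U"
    unfolding U_def
  proof (rule uniform_limit_theorem)
    show "uniform_limit {a..b} (\<lambda>n x. \<Sum>k<n. c k * G k x) (\<lambda>x. \<Sum>k. c k * G k x) sequentially"
      using cG_le summable_b by (intro Weierstrass_m_test) auto
    show "\<forall>\<^sub>F n in sequentially. continuous_on {a..b} (\<lambda>x. \<Sum>k<n. c k * G k x)"
      unfolding G_def
      by (intro always_eventually allI continuous_intros indefinite_integral_continuous_1 int_ind V_sets)
  qed simp
  have "laplace_major h a b U"
  proof (rule laplace_majorI_slope[OF U_cont])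
    fix x assume x: "x \<in> {a..b}"
    \<comment> \<open>Near \<open>x\<close> the open set \<open>V k\<close> is full, so
      \<open>G k\<close> has slope 1 there and its term alone has slope
      \<open>c k \<ge> h x\<close>; the other terms are nondecreasing and can only add to
      this.\<close>
    define k where "k = nat \<lfloor>h x / \<delta>\<rfloor>"
    have "real k \<le> h x / \<delta>" "h x / \<delta> < real k + 1"
      using pos[OF x] \<delta> by (auto simp: k_def)
    then have "x \<in> E k" and hc: "h x \<le> c k"
      using x \<delta> by (auto simp: E_def c_def field_simps)
    then obtain r where r: "r > 0" "ball x r \<subseteq> V k"
      using V(1,2)[of k] open_contains_ball by blast
    have "h x * (z - y) \<le> U z - U y" if yz: "a \<le> y" "y \<le> z" "z \<le> b" "x - r < y" "z < x + r" for y z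
    proof -
      have "{y..z} \<subseteq> V k"
        using r(2) yz by (force simp: ball_def dist_real_def)
      then have "integral {y..z} (indicat_real (V k)) = integral {y..z} (\<lambda>_. 1)"
        by (intro integral_cong) auto
      then have "G k z - G k y = z - y"
        using yz G_diff[of y z k] by simp
      then have "h x * (z - y) \<le> c k * (G k z - G k y)"
        using hc yz by (simp add: mult_right_mono)
      also have "\<dots> = (\<Sum>j\<in>{k}. c j * G j z - c j * G j y)"
        by (simp add: algebra_simps)
      also have "\<dots> \<le> (\<Sum>j. c j * G j z - c j * G j y)"
        using yz c G_mono by (intro sum_le_suminf summable_diff summable) (auto simp: mult_left_mono less_imp_le)
      also have "\<dots> = U z - U y"
        unfolding U_def using yz by (intro suminf_diff[symmetric] summable) auto
      finally show ?thesis .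
    qed
    then show "\<exists>r>0. \<forall>y z. a \<le> y \<and> y \<le> z \<and> z \<le> b \<and> x - r < y \<and> z < x + r \<longrightarrow> h x * (z - y) \<le> U z - U y"
      using r(1) by blast
  qed
  moreover have "U b \<le> integral {a..b} h + \<delta> * (b - a) + e / 2"
    unfolding U_def using sum_G by (intro suminf_le_const summable_b)
  moreover have "U a = 0"
    by (simp add: U_def G_a)
  ultimately show ?thesis
    using \<delta>(2) by (intro that[of U]) auto
qed

text \<open>Reflection turns a major function into a minor one but requires an upper bound, hence
  the truncation at height \<open>n\<close>. A major function \<open>W\<close> of
  \<open>n - min h n\<close> gives the minor function \<open>n * x - W x\<close> of
  \<open>min h n\<close>, which is also one of the larger function \<open>h\<close>.\<close>

lemma integrable_nonneg_laplace_minor: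
  assumes h: "h integrable_on {a..b}" and pos: "\<And>x. x \<in> {a..b} \<Longrightarrow> 0 \<le> h x" and "a \<le> b" "e > 0"
  obtains V where "laplace_minor h a b V" "integral {a..b} h - e < V b - V a"
proof -
  have "\<forall>\<^sub>F n in sequentially. integral {a..b} h - e / 2 < integral {a..b} (\<lambda>x. min (h x) (real n))"
    using order_tendstoD(1)[OF integral_min_const_tendsto[OF h pos]] \<open>e > 0\<close> by simp
  then obtain n where n: "integral {a..b} h - e / 2 < integral {a..b} (\<lambda>x. min (h x) (real n))"
    by (auto simp: eventually_sequentially)
  let ?q = "\<lambda>x. real n - min (h x) (real n)"
  have q: "?q integrable_on {a..b}"
    by (intro integrable_diff integrable_const_ivl integrable_on_min_const h pos)
  obtain W where W: "laplace_major ?q a b W" "W b - W a < integral {a..b} ?q + e / 2"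
    using integrable_nonneg_laplace_major[OF q _ \<open>a \<le> b\<close>, of "e / 2"] \<open>e > 0\<close> by auto
  have int_q: "integral {a..b} ?q = real n * (b - a) - integral {a..b} (\<lambda>x. min (h x) (real n))"
    using \<open>a \<le> b\<close> by (subst integral_diff) (auto intro!: integrable_on_min_const h pos)
  have "laplace_major (\<lambda>_. - real n) a b (\<lambda>x. - real n * x)"
    by (rule laplace_majorI_slope) (auto intro!: continuous_intros exI[of _ 1] simp: algebra_simps)
  from laplace_major_add[OF W(1) this]
  have "laplace_major (\<lambda>x. - min (h x) (real n)) a b (\<lambda>x. - (real n * x - W x))"
    by simp
  then have "laplace_major (\<lambda>x. - h x) a b (\<lambda>x. - (real n * x - W x))"
    by (rule laplace_major_weaken) auto
  then have "laplace_minor h a b (\<lambda>x. real n * x - W x)"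
    by (simp add: laplace_minor_iff)
  then show ?thesis
    using W(2) n int_q by (intro that[of "\<lambda>x. real n * x - W x"]) (auto simp: algebra_simps)
qed

lemma has_laplace_integral_nonneg:
  assumes "h integrable_on {a..b}" "\<And>x. x \<in> {a..b} \<Longrightarrow> 0 \<le> h x" "a \<le> b"
  shows "has_laplace_integral h a b (integral {a..b} h)"
  unfolding has_laplace_integral_def
  using integrable_nonneg_laplace_major[OF assms] integrable_nonneg_laplace_minor[OF assms] by metis

theorem has_laplace_integral_absolutely_integrable:
  assumes h: "h absolutely_integrable_on {a..b}" and "a \<le> b"
  shows "has_laplace_integral h a b (integral {a..b} h)"
proof -
  have "(\<lambda>x. - h x) absolutely_integrable_on {a..b}" "(\<lambda>_. 0 :: real) absolutely_integrable_on {a..b}"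
    using absolutely_integrable_on_const[of "{a..b}" "0 :: real"] absolutely_integrable_scaleR_left[OF h, of "-1"] by auto
  then have "(\<lambda>x. max (h x) 0) absolutely_integrable_on {a..b}" "(\<lambda>x. max (- h x) 0) absolutely_integrable_on {a..b}"
    using h by (auto intro: absolutely_integrable_max_1)
  then have int: "(\<lambda>x. max (h x) 0) integrable_on {a..b}" "(\<lambda>x. max (- h x) 0) integrable_on {a..b}"
    using set_lebesgue_integral_eq_integral(1) by blast+
  have "has_laplace_integral (\<lambda>x. max (h x) 0 - max (- h x) 0) a b
      (integral {a..b} (\<lambda>x. max (h x) 0) - integral {a..b} (\<lambda>x. max (- h x) 0))"
    by (intro has_laplace_integral_diff has_laplace_integral_nonneg int \<open>a \<le> b\<close>) auto
  moreover have "(\<lambda>x. max (h x) 0 - max (- h x) 0) = h"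
    by (auto simp: max_def)
  moreover have "integral {a..b} (\<lambda>x. max (h x) 0) - integral {a..b} (\<lambda>x. max (- h x) 0)
      = integral {a..b} (\<lambda>x. max (h x) 0 - max (- h x) 0)"
    by (rule integral_diff[symmetric]) (fact int)+
  ultimately show ?thesis by simp
qed

section \<open>Nonnegative Laplace integrable functions are Lebesgue integrable\<close>

lemma AE_lebesgue_imp_negligible:
  assumes "AE x in lebesgue. P x"
  shows "negligible {x. \<not> P x}"
proof -
  obtain N where "N \<in> null_sets lebesgue" "{x. \<not> P x} \<subseteq> N"
    using assms unfolding eventually_ae_filter by auto
  then show ?thesis
    using negligible_iff_null_sets negligible_subset by blast
qed

section \<open>Laplace averages of nondecreasing functions\<close>

lemma lap_op_linear_le: "lap_op (\<lambda>t. c * t) e s \<le> c" if "0 < e" "0 < s" "0 \<le> c"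
proof -
  have "lap_op (\<lambda>t. c * t) e s = c * (1 - exp (- s * e) * (1 + s * e))"
    using that by (simp add: lap_op_linear_eq)
  also have "\<dots> \<le> c * 1"
    using that by (intro mult_left_mono) auto
  finally show ?thesis by simp
qed

text \<open>The window is 1 for every \<open>x\<close>, in place of \<open>b - x\<close>; the mean
  is then continuous in \<open>x\<close>, and integration in \<open>x\<close> and in
  \<open>t\<close> can be interchanged over a rectangle.\<close>

definition lap_mean :: "(real \<Rightarrow> real) \<Rightarrow> real \<Rightarrow> real \<Rightarrow> real" where
  "lap_mean W s x = lap_op (\<lambda>t. W (x + t) - W x) 1 s"

lemma continuous_on_lap_mean:
  assumes W: "continuous_on UNIV W"
  shows "continuous_on A (lap_mean W s)"
proof -
  have "continuous_on (A \<times> cbox 0 1) (\<lambda>(x, t). exp (- s * t) * (W (x + t) - W x))"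
    unfolding case_prod_unfold by (intro continuous_intros continuous_on_compose2[OF W]) auto
  from integral_continuous_on_param[OF this] show ?thesis
    unfolding lap_mean_def lap_op_def by (intro continuous_intros) simp
qed

lemma lap_mean_nonneg:
  assumes W: "continuous_on UNIV W" "mono W"
  shows "0 \<le> lap_mean W s x"
proof -
  have "lap_op (\<lambda>_. 0) 1 s \<le> lap_op (\<lambda>t. W (x + t) - W x) 1 s"
    using monoD[OF W(2)] by (intro lap_op_mono continuous_intros continuous_on_compose2[OF W(1)]) auto
  then show ?thesis
    by (simp add: lap_mean_def lap_op_def)
qed

text \<open>Translation leaves only two boundary pieces, the integrals of \<open>W\<close> over
  \<open>{b..b+t}\<close> and \<open>{a..a+t}\<close>. On the first \<open>W\<close> is constantly
  \<open>W b\<close>, on the second it is at least \<open>W a\<close>.\<close>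

lemma integral_increment_le:
  fixes W :: "real \<Rightarrow> real"
  assumes W: "continuous_on UNIV W" "mono W" and W_b: "\<And>x. b \<le> x \<Longrightarrow> W x = W b"
    and "a \<le> b" "0 \<le> t"
  shows "integral {a..b} (\<lambda>x. W (x + t) - W x) \<le> (W b - W a) * t"
proof -
  have int: "W integrable_on {x..y}" for x y
    using W by (intro integrable_continuous_interval) (auto intro: continuous_on_subset)
  have "integral {a..b} (\<lambda>x. W (x + t) - W x) = integral {a..b} (\<lambda>x. W (x + t)) - integral {a..b} W"
    by (intro integral_diff int integrable_continuous_interval continuous_intros
        continuous_on_compose2[OF W(1)]) auto
  also have "integral {a..b} (\<lambda>x. W (x + t)) = integral {a+t..b+t} W"
    using integral_shift_Icc_real[of a b W t] by (simp add: comp_def add.commute)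
  also have "integral {a+t..b+t} W - integral {a..b} W = integral {b..b+t} W - integral {a..a+t} W"
  proof -
    have "integral {a..a+t} W + integral {a+t..b+t} W = integral {a..b+t} W"
      using \<open>a \<le> b\<close> \<open>0 \<le> t\<close> by (intro Henstock_Kurzweil_Integration.integral_combine int) auto
    moreover have "integral {a..b} W + integral {b..b+t} W = integral {a..b+t} W"
      using \<open>a \<le> b\<close> \<open>0 \<le> t\<close> by (intro Henstock_Kurzweil_Integration.integral_combine int) auto
    ultimately show ?thesis by linarith
  qed
  also have "integral {b..b+t} W = integral {b..b+t} (\<lambda>_. W b)"
    by (rule integral_cong, rule W_b) simp
  also have "\<dots> = W b * t"
    using \<open>0 \<le> t\<close> by simp
  finally have "integral {a..b} (\<lambda>x. W (x + t) - W x) = W b * t - integral {a..a+t} W" .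
  moreover have "integral {a..a+t} (\<lambda>_. W a) \<le> integral {a..a+t} W"
    using monoD[OF W(2)] by (intro integral_le int integrable_const_ivl) auto
  ultimately show ?thesis
    using \<open>0 \<le> t\<close> by (simp add: algebra_simps)
qed

text \<open>Exchanging the integrations gives the Laplace average of \<open>?K t\<close>, which is
  at most \<open>(W b - W a) * t\<close>; the density \<open>s^2 * t * exp (- s * t)\<close> has
  mass at most 1 on \<open>{0..1}\<close>.\<close>

lemma integral_lap_mean_le:
  fixes W :: "real \<Rightarrow> real"
  assumes W: "continuous_on UNIV W" "mono W" and W_b: "\<And>x. b \<le> x \<Longrightarrow> W x = W b"
    and "a \<le> b" "0 < s"
  shows "integral {a..b} (lap_mean W s) \<le> W b - W a"
proof -
  let ?K = "\<lambda>t. integral {a..b} (\<lambda>x. W (x + t) - W x)"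
  have "integral {a..b} (lap_mean W s)
      = s\<^sup>2 * integral (cbox a b) (\<lambda>x. integral (cbox 0 1) (\<lambda>t. exp (- s * t) * (W (x + t) - W x)))"
    by (simp add: lap_mean_def[abs_def] lap_op_def)
  also have "\<dots> = s\<^sup>2 * integral (cbox 0 1) (\<lambda>t. integral (cbox a b) (\<lambda>x. exp (- s * t) * (W (x + t) - W x)))"
    by (subst integral_swap_continuous)
       (auto simp: case_prod_unfold intro!: continuous_intros continuous_on_compose2[OF W(1)])
  also have "\<dots> = lap_op ?K 1 s"
    by (simp add: lap_op_def)
  also have "\<dots> \<le> lap_op (\<lambda>t. (W b - W a) * t) 1 s"
  proof (rule lap_op_mono)
    have "continuous_on ({0..1} \<times> cbox a b) (\<lambda>(t, x). W (x + t) - W x)"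
      unfolding case_prod_unfold by (intro continuous_intros continuous_on_compose2[OF W(1)]) auto
    from integral_continuous_on_param[OF this] show "continuous_on {0..1} ?K"
      by simp
    show "?K t \<le> (W b - W a) * t" if "t \<in> {0..1}" for t
      using that by (intro integral_increment_le assms) auto
  qed (intro continuous_intros)
  also have "\<dots> \<le> W b - W a"
    using monoD[OF W(2) \<open>a \<le> b\<close>] \<open>0 < s\<close> by (intro lap_op_linear_le) auto
  finally show ?thesis .
qed

text \<open>Running over integers makes this a countable liminf of continuous functions, hence
  Borel. Values in \<open>ennreal\<close> lose nothing for nondecreasing \<open>W\<close>, whose
  means are nonnegative.\<close>

definition lap_deriv :: "(real \<Rightarrow> real) \<Rightarrow> real \<Rightarrow> ennreal" where
  "lap_deriv W x = liminf (\<lambda>n. ennreal (lap_mean W (real n) x))"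

lemma borel_measurable_lap_mean:
  "continuous_on UNIV W \<Longrightarrow> lap_mean W s \<in> borel_measurable borel"
  by (intro borel_measurable_continuous_onI continuous_on_lap_mean)

lemma borel_measurable_lap_deriv:
  "continuous_on UNIV W \<Longrightarrow> lap_deriv W \<in> borel_measurable borel"
  unfolding lap_deriv_def[abs_def] using borel_measurable_lap_mean by measurable

lemma nn_integral_lap_deriv_le:
  fixes W :: "real \<Rightarrow> real"
  assumes W: "continuous_on UNIV W" "mono W" and W_b: "\<And>x. b \<le> x \<Longrightarrow> W x = W b" and "a \<le> b"
  shows "(\<integral>\<^sup>+x. lap_deriv W x * indicator {a..b} x \<partial>lborel) \<le> ennreal (W b - W a)"
proof -
  have [measurable]: "lap_mean W s \<in> borel_measurable borel" for s
    by (rule borel_measurable_lap_mean[OF W(1)])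
  have "(\<integral>\<^sup>+x. lap_deriv W x * indicator {a..b} x \<partial>lborel)
      = (\<integral>\<^sup>+x. liminf (\<lambda>n. ennreal (lap_mean W (real n) x * indicator {a..b} x)) \<partial>lborel)"
    unfolding lap_deriv_def by (intro nn_integral_cong) (auto split: split_indicator simp: Liminf_const)
  also have "\<dots> \<le> liminf (\<lambda>n. \<integral>\<^sup>+x. ennreal (lap_mean W (real n) x * indicator {a..b} x) \<partial>lborel)"
    by (intro nn_integral_liminf) measurable
  also have "\<dots> \<le> liminf (\<lambda>n. ennreal (W b - W a))"
  \<comment> \<open>The index starts at 1 because the bound on the integrated mean is for positive
    parameters.\<close>
  proof (rule Liminf_mono, rule eventually_sequentiallyI[of 1])
    fix n :: nat assume "1 \<le> n"
    have "lap_mean W (real n) integrable_on {a..b}"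
      by (intro integrable_continuous_interval continuous_on_lap_mean W)
    then have "((\<lambda>x. if x \<in> {a..b} then lap_mean W (real n) x else 0) has_integral integral {a..b} (lap_mean W (real n))) UNIV"
      unfolding has_integral_restrict_UNIV by (rule integrable_integral)
    then have "((\<lambda>x. lap_mean W (real n) x * indicator {a..b} x) has_integral integral {a..b} (lap_mean W (real n))) UNIV"
      by (rule has_integral_eq[rotated]) (auto simp: indicator_def)
    then have "(\<integral>\<^sup>+x. ennreal (lap_mean W (real n) x * indicator {a..b} x) \<partial>lborel) = ennreal (integral {a..b} (lap_mean W (real n)))"
      by (intro nn_integral_has_integral_lborel) (auto simp: lap_mean_nonneg W)
    also have "\<dots> \<le> ennreal (W b - W a)"
      using \<open>1 \<le> n\<close> by (intro ennreal_leI integral_lap_mean_le assms) auto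
    finally show "(\<integral>\<^sup>+x. ennreal (lap_mean W (real n) x * indicator {a..b} x) \<partial>lborel) \<le> ennreal (W b - W a)" .
  qed
  finally show ?thesis
    by (simp add: Liminf_const)
qed

text \<open>Extending by the boundary values gives sense to \<open>W (x + t)\<close> for
  \<open>x\<close> near \<open>b\<close> and keeps continuity and monotonicity; being constant
  beyond \<open>b\<close>, the extension adds nothing to the total increment.\<close>

definition clamp_ext :: "real \<Rightarrow> real \<Rightarrow> (real \<Rightarrow> real) \<Rightarrow> real \<Rightarrow> real" where
  "clamp_ext a b W x = W (max a (min b x))"

lemma clamp_ext_eq: "x \<in> {a..b} \<Longrightarrow> clamp_ext a b W x = W x"
  by (simp add: clamp_ext_def)

lemma continuous_on_clamp_ext:
  assumes "a \<le> b" "continuous_on {a..b} W"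
  shows "continuous_on UNIV (clamp_ext a b W)"
  unfolding clamp_ext_def[abs_def]
proof (rule continuous_on_compose2[OF assms(2)])
  show "continuous_on UNIV (\<lambda>x. max a (min b x))"
    by (intro continuous_intros)
qed (use assms(1) in auto)

lemma mono_clamp_ext:
  assumes W: "laplace_major (\<lambda>_. 0) a b W" and "a \<le> b"
  shows "mono (clamp_ext a b W)"
proof (rule monoI)
  fix x y :: real assume "x \<le> y"
  then show "clamp_ext a b W x \<le> clamp_ext a b W y"
    unfolding clamp_ext_def using \<open>a \<le> b\<close>
    by (intro laplace_major_zero_le[OF laplace_major_subinterval[OF W]]) (auto simp: max_def min_def)
qed

text \<open>The windows \<open>b - x\<close> of the derivate and 1 of the mean are both truncated to
  their minimum, on which \<open>U\<close> and its extension agree. That minimum is positive because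
  \<open>x < b\<close>.\<close>

lemma eventually_lap_mean_gt:
  assumes U: "laplace_major f a b U" and x: "a \<le> x" "x < b" and "0 < e"
  shows "\<forall>\<^sub>F n in sequentially. f x - e < lap_mean (clamp_ext a b U) (real n) x"
proof -
  let ?U = "clamp_ext a b U"
  have c: "continuous_on {a..b} U"
    using U by (simp add: laplace_major_iff)
  then have c': "continuous_on UNIV ?U"
    using continuous_on_clamp_ext x by simp
  define d where "d = min 1 (b - x)"
  have "lap_ge (\<lambda>t. U (x + t) - U x) (b - x) (f x)"
    using U x by (simp add: laplace_major_iff)
  then have "lap_ge (\<lambda>t. U (x + t) - U x) d (f x)"
    using lap_ge_truncate[OF continuous_on_increment(1)[OF c], of x d] x by (simp add: d_def)
  then have "lap_ge (\<lambda>t. ?U (x + t) - ?U x) d (f x)"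
    using x by (subst lap_ge_cong) (auto simp: clamp_ext_eq d_def)
  moreover have "continuous_on {0..1} (\<lambda>t. ?U (x + t) - ?U x)"
    by (intro continuous_intros continuous_on_compose2[OF c']) auto
  ultimately have "lap_ge (\<lambda>t. ?U (x + t) - ?U x) 1 (f x)"
    using lap_ge_truncate[of 1 "\<lambda>t. ?U (x + t) - ?U x" d] x by (simp add: d_def)
  then have "\<forall>\<^sub>F s in at_top. f x - e < lap_mean ?U s x"
    using \<open>0 < e\<close> by (simp add: lap_ge_def lap_mean_def)
  then show ?thesis
    using filterlim_real_sequentially by (rule eventually_compose_filterlim)
qed

lemma laplace_major_le_lap_deriv:
  assumes U: "laplace_major f a b U" and x: "a \<le> x" "x < b"
  shows "ennreal (f x) \<le> lap_deriv (clamp_ext a b U) x"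
proof (rule ennreal_le_epsilon)
  fix e :: real assume "0 < e"
  have "ennreal (f x - e) \<le> lap_deriv (clamp_ext a b U) x"
    unfolding lap_deriv_def
    by (rule Liminf_bounded, rule eventually_mono[OF eventually_lap_mean_gt[OF U x \<open>0 < e\<close>]])
       (simp add: ennreal_leI)
  then have "ennreal (f x - e) + ennreal e \<le> lap_deriv (clamp_ext a b U) x + ennreal e"
    by (rule add_right_mono)
  moreover have "ennreal (f x) \<le> ennreal (f x - e) + ennreal e"
  proof (cases "f x \<ge> e")
    case False
    then show ?thesis by (intro order_trans[OF ennreal_leI[of "f x" e]]) auto
  qed (use \<open>0 < e\<close> in \<open>simp flip: ennreal_plus\<close>)
  ultimately show "ennreal (f x) \<le> lap_deriv (clamp_ext a b U) x + ennreal e"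
    by order
qed

text \<open>\<open>U\<close> is the sum of \<open>V\<close> and \<open>U - V\<close>, and the
  averages of a minor function \<open>V\<close> are eventually below \<open>f x + e\<close>. So the
  derivate of \<open>U\<close> overshoots \<open>f x\<close> by at most that of
  \<open>U - V\<close>, whose integral is controlled by the gap between the two functions.\<close>

lemma lap_deriv_le_diff:
  assumes U: "laplace_major f a b U" and V: "laplace_minor f a b V" and x: "a \<le> x" "x < b" and "0 \<le> f x"
  shows "lap_deriv (clamp_ext a b U) x \<le> ennreal (f x) + lap_deriv (clamp_ext a b (\<lambda>x. U x - V x)) x"
proof (rule ennreal_le_epsilon)
  fix e :: real assume "0 < e"
  let ?U = "clamp_ext a b U" and ?V = "clamp_ext a b (\<lambda>x. - V x)" and ?W = "clamp_ext a b (\<lambda>x. U x - V x)"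
  have cU: "continuous_on UNIV ?U" and cV: "continuous_on UNIV ?V"
    using U V x by (auto intro!: continuous_on_clamp_ext simp: laplace_major_iff laplace_minor_iff)
  have eq: "lap_mean ?W s x = lap_mean ?U s x + lap_mean ?V s x" for s
  proof -
    have "lap_mean ?W s x = lap_op (\<lambda>t. (?U (x + t) - ?U x) + (?V (x + t) - ?V x)) 1 s"
      by (simp add: lap_mean_def clamp_ext_def algebra_simps)
    also have "\<dots> = lap_mean ?U s x + lap_mean ?V s x"
      unfolding lap_mean_def
      by (intro lap_op_add continuous_intros continuous_on_compose2[OF cU] continuous_on_compose2[OF cV]) auto
    finally show ?thesis .
  qed
  have "\<forall>\<^sub>F n in sequentially. - f x - e < lap_mean ?V (real n) x"
    using eventually_lap_mean_gt[OF V[unfolded laplace_minor_iff] x \<open>0 < e\<close>] .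
  then have "\<forall>\<^sub>F n in sequentially. ennreal (lap_mean ?U (real n) x) \<le> ennreal (f x + e) + ennreal (lap_mean ?W (real n) x)"
  proof eventually_elim
    case (elim n)
    \<comment> \<open>The maximum with 0 mirrors \<open>ennreal\<close>, which sends negative reals
      to 0, so the inequality survives the embedding.\<close>
    then have "lap_mean ?U (real n) x \<le> (f x + e) + max 0 (lap_mean ?W (real n) x)"
      using eq[of "real n"] by auto
    then have "ennreal (lap_mean ?U (real n) x) \<le> ennreal ((f x + e) + max 0 (lap_mean ?W (real n) x))"
      by (rule ennreal_leI)
    also have "\<dots> = ennreal (f x + e) + ennreal (lap_mean ?W (real n) x)"
      using \<open>0 \<le> f x\<close> \<open>0 < e\<close> by (subst ennreal_plus) (auto simp: max_def ennreal_neg)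
    finally show ?case .
  qed
  then have "lap_deriv ?U x \<le> liminf (\<lambda>n. ennreal (f x + e) + ennreal (lap_mean ?W (real n) x))"
    unfolding lap_deriv_def by (rule Liminf_mono)
  also have "\<dots> = ennreal (f x + e) + lap_deriv ?W x"
    unfolding lap_deriv_def by (rule Liminf_const_add) (auto intro!: continuous_intros)
  also have "\<dots> = ennreal (f x) + lap_deriv ?W x + ennreal e"
    using \<open>0 \<le> f x\<close> \<open>0 < e\<close> by (subst ennreal_plus) (auto simp: ac_simps)
  finally show "lap_deriv ?U x \<le> ennreal (f x) + lap_deriv ?W x + ennreal e" .
qed

text \<open>By Fatou the lower derivate of a monotone \<open>W\<close> has integral at most \<open>W b - W a\<close>. So the infimum
  of the derivates of major functions \<open>U k\<close> exceeds \<open>h\<close> by a null function, which makes \<open>h\<close> measurable.\<close>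

lemma laplace_integrable_nonneg_imp_integrable:
  assumes h: "laplace_integrable h a b" and pos: "\<And>x. x \<in> {a..b} \<Longrightarrow> 0 \<le> h x" and "a \<le> b"
  shows "h integrable_on {a..b}"
proof -
  have "has_laplace_integral h a b (laplace_integral h a b)"
    using h has_laplace_integral_iff[OF \<open>a \<le> b\<close>] by blast
  then have "\<exists>U V. laplace_major h a b U \<and> laplace_minor h a b V \<and>
     U b - U a < laplace_integral h a b + 1 / (real k + 1) \<and> laplace_integral h a b - 1 / (real k + 1) < V b - V a" for k :: nat
    unfolding has_laplace_integral_def by simp
  then obtain U V where UV: "\<And>k. laplace_major h a b (U k)" "\<And>k. laplace_minor h a b (V k)"
    and gap: "\<And>k. U k b - U k a < laplace_integral h a b + 1 / (real k + 1)"
      "\<And>k. laplace_integral h a b - 1 / (real k + 1) < V k b - V k a"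
    by metis
  define W where "W k x = U k x - V k x" for k x
  define DU where "DU k = lap_deriv (clamp_ext a b (U k))" for k
  define DW where "DW k = lap_deriv (clamp_ext a b (W k))" for k
  have major0: "laplace_major (\<lambda>_. 0) a b (U k)" "laplace_major (\<lambda>_. 0) a b (W k)" for k
    using laplace_major_weaken[OF UV(1), of "\<lambda>_. 0" k] pos laplace_major_minus_minor[OF UV(1) UV(2)]
    unfolding W_def by auto
  have cont: "continuous_on UNIV (clamp_ext a b (U k))" "continuous_on UNIV (clamp_ext a b (W k))" for k
    using major0[of k] \<open>a \<le> b\<close> by (auto intro!: continuous_on_clamp_ext simp: laplace_major_iff)
  have [measurable]: "DU k \<in> borel_measurable borel" "DW k \<in> borel_measurable borel" for k
    unfolding DU_def DW_def by (intro borel_measurable_lap_deriv cont)+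
  have int_DU: "(\<integral>\<^sup>+x. DU k x * indicator {a..b} x \<partial>lborel) \<le> ennreal (U k b - U k a)" for k
    using nn_integral_lap_deriv_le[OF cont(1)[of k] mono_clamp_ext[OF major0(1)[of k] \<open>a \<le> b\<close>], of b a] \<open>a \<le> b\<close>
    by (simp add: DU_def clamp_ext_def)
  have int_DW: "(\<integral>\<^sup>+x. DW k x * indicator {a..b} x \<partial>lborel) \<le> ennreal (W k b - W k a)" for k
    using nn_integral_lap_deriv_le[OF cont(2)[of k] mono_clamp_ext[OF major0(2)[of k] \<open>a \<le> b\<close>], of b a] \<open>a \<le> b\<close>
    by (simp add: DW_def clamp_ext_def)
  \<comment> \<open>A Borel function squeezed on \<open>[a,b)\<close> between \<open>h\<close> and
    \<open>h + DW k\<close> for every \<open>k\<close>; nothing is known yet about measurability of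
    \<open>h\<close> itself.\<close>
  define m where "m x = (INF k. DU k x)" for x
  have [measurable]: "m \<in> borel_measurable borel"
    unfolding m_def[abs_def] by measurable
  have le_m: "ennreal (h x) \<le> m x" if "a \<le> x" "x < b" for x
    unfolding m_def DU_def using laplace_major_le_lap_deriv[OF UV(1) that] by (intro INF_greatest)
  have m_le: "m x \<le> ennreal (h x) + DW k x" if "a \<le> x" "x < b" for x k
  proof -
    have "m x \<le> DU k x"
      unfolding m_def by (intro INF_lower) auto
    also have "\<dots> \<le> ennreal (h x) + DW k x"
      unfolding DU_def DW_def W_def using lap_deriv_le_diff[OF UV(1) UV(2) that] pos that by simp
    finally show ?thesis .
  qed
  \<comment> \<open>Lying below each \<open>DW k\<close> on the interval, \<open>w\<close>
    integrates to at most \<open>2 / (k + 1)\<close> for all \<open>k\<close>; the 2 collects the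
    errors of \<open>U k\<close> and of \<open>V k\<close>.\<close>
  define w where "w x = (INF k. DW k x * indicator {a..b} x)" for x
  have [measurable]: "w \<in> borel_measurable borel"
    unfolding w_def[abs_def] by measurable
  have "(\<integral>\<^sup>+x. w x \<partial>lborel) \<le> ennreal (2 / (real k + 1))" for k
  proof -
    have "(\<integral>\<^sup>+x. w x \<partial>lborel) \<le> (\<integral>\<^sup>+x. DW k x * indicator {a..b} x \<partial>lborel)"
      unfolding w_def by (intro nn_integral_mono INF_lower) auto
    also have "\<dots> \<le> ennreal (W k b - W k a)"
      by (rule int_DW)
    also have "\<dots> \<le> ennreal (2 / (real k + 1))"
      using gap[of k] by (intro ennreal_leI) (simp add: W_def)
    finally show ?thesis .
  qed
  moreover have "(\<lambda>k. ennreal (2 / (real k + 1))) \<longlonglongrightarrow> ennreal 0"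
  proof (rule tendsto_ennrealI)
    have "(\<lambda>k. 2 * inverse (real (Suc k))) \<longlonglongrightarrow> 2 * 0"
      by (intro tendsto_intros LIMSEQ_inverse_real_of_nat)
    then show "(\<lambda>k. 2 / (real k + 1)) \<longlonglongrightarrow> 0"
      by (simp add: divide_inverse add.commute)
  qed
  ultimately have "(\<integral>\<^sup>+x. w x \<partial>lborel) \<le> ennreal 0"
    by (intro LIMSEQ_le_const[of _ "ennreal 0"]) blast+
  then have "AE x in lborel. w x = 0"
    by (simp add: nn_integral_0_iff_AE)
  \<comment> \<open>The bounds on \<open>m\<close> come from right derivates, which exist only to
    the left of \<open>b\<close>, so this point is discarded as well.\<close>
  then have "AE x in lborel. w x = 0 \<and> x \<noteq> b"
    using AE_lborel_singleton[of b] by eventually_elim simp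
  then have AE: "AE x in lebesgue. w x = 0 \<and> x \<noteq> b"
    by (rule AE_completion)
  have eq: "h x = enn2real (m x)" if "x \<in> {a..b}" "w x = 0" "x \<noteq> b" for x
  proof -
    have x: "a \<le> x" "x < b" using that by auto
    have "m x \<le> ennreal (h x)"
    proof (rule ennreal_le_epsilon)
      fix e :: real assume "0 < e"
      then have "(INF k. DW k x) < ennreal e"
        using that by (simp add: w_def)
      then obtain k where "DW k x < ennreal e"
        by (auto simp: INF_less_iff)
      then have "ennreal (h x) + DW k x \<le> ennreal (h x) + ennreal e"
        by (intro add_left_mono) simp
      with m_le[OF x, of k] show "m x \<le> ennreal (h x) + ennreal e"
        by order
    qed
    then have "m x = ennreal (h x)"
      using le_m[OF x] by (rule antisym)
    then show ?thesis
      using pos[OF that(1)] by simp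
  qed
  \<comment> \<open>\<open>enn2real\<close> sends an infinite value to 0 and so never exceeds
    \<open>m\<close>; the single function \<open>DU 0\<close>, of finite integral,
    dominates.\<close>
  have "integrable lborel (\<lambda>x. enn2real (m x) * indicator {a..b} x)"
  proof (rule integrableI_nonneg)
    have "(\<integral>\<^sup>+x. ennreal (enn2real (m x) * indicator {a..b} x) \<partial>lborel) \<le> (\<integral>\<^sup>+x. DU 0 x * indicator {a..b} x \<partial>lborel)"
    proof (intro nn_integral_mono)
      fix x :: real
      have "ennreal (enn2real (m x)) \<le> m x"
        by (cases "m x") auto
      also have "\<dots> \<le> DU 0 x"
        unfolding m_def by (intro INF_lower) auto
      finally show "ennreal (enn2real (m x) * indicator {a..b} x) \<le> DU 0 x * indicator {a..b} x"
        by (auto split: split_indicator)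
    qed
    also have "\<dots> < \<infinity>"
      by (rule le_less_trans[OF int_DU]) simp
    finally show "(\<integral>\<^sup>+x. ennreal (enn2real (m x) * indicator {a..b} x) \<partial>lborel) < \<infinity>" .
  qed auto
  then have "(\<lambda>x. enn2real (m x) * indicator {a..b} x) integrable_on UNIV"
    by (rule integrable_on_lborel)
  then have "(\<lambda>x. if x \<in> {a..b} then enn2real (m x) else 0) integrable_on UNIV"
    by (rule integrable_eq) auto
  then have int: "(\<lambda>x. enn2real (m x)) integrable_on {a..b}"
    by (simp only: integrable_restrict_UNIV)
  have "negligible {x. \<not> (w x = 0 \<and> x \<noteq> b)}"
    by (rule AE_lebesgue_imp_negligible[OF AE])
  from integrable_spike[OF int this] show ?thesis
    using eq by auto
qed

section \<open>Equi-absolute continuity\<close>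

definition interval_family :: "real \<Rightarrow> real \<Rightarrow> (real \<times> real) set \<Rightarrow> bool" where
  "interval_family a b S \<longleftrightarrow> finite S \<and> (\<forall>(x, y)\<in>S. a \<le> x \<and> x \<le> y \<and> y \<le> b) \<and>
     (\<forall>p\<in>S. \<forall>q\<in>S. p \<noteq> q \<longrightarrow> snd p \<le> fst q \<or> snd q \<le> fst p)"

lemma equiabs_continuous_iff:
  "equiabs_continuous H a b \<longleftrightarrow> (\<forall>\<epsilon>>0. \<exists>\<eta>>0. \<forall>S. interval_family a b S \<longrightarrow>
     (\<Sum>(x, y)\<in>S. y - x) < \<eta> \<longrightarrow> (\<forall>n. (\<Sum>(x, y)\<in>S. \<bar>H n y - H n x\<bar>) < \<epsilon>))"
  unfolding equiabs_continuous_def interval_family_def by (simp only: imp_conjL)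

lemma equiabs_continuous_cong:
  assumes "\<And>n x. x \<in> {a..b} \<Longrightarrow> H n x = K n x"
  shows "equiabs_continuous H a b = equiabs_continuous K a b"
proof -
  have "(\<Sum>(x, y)\<in>S. \<bar>H n y - H n x\<bar>) = (\<Sum>(x, y)\<in>S. \<bar>K n y - K n x\<bar>)" if "interval_family a b S" for S n
    using that assms by (intro sum.cong) (auto simp: interval_family_def)
  then show ?thesis
    unfolding equiabs_continuous_iff by simp
qed

lemma integrable_on_subset_Icc:
  fixes q :: "real \<Rightarrow> real"
  shows "q integrable_on {a..b} \<Longrightarrow> a \<le> x \<Longrightarrow> y \<le> b \<Longrightarrow> q integrable_on {x..y}"
  by (rule integrable_on_subinterval) auto

lemma integral_diff_Icc:
  fixes q :: "real \<Rightarrow> real"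
  assumes "q integrable_on {a..b}" "a \<le> x" "x \<le> y" "y \<le> b"
  shows "integral {a..y} q - integral {a..x} q = integral {x..y} q"
  using Henstock_Kurzweil_Integration.integral_combine[OF assms(2,3) integrable_on_subset_Icc[OF assms(1) order_refl assms(4)]]
  by simp

text \<open>The interiors are pairwise disjoint, so each point is counted at most once. Replacing
  the closed intervals by their interiors keeps the integrals and removes shared endpoints.\<close>

lemma sum_integral_le:
  fixes q :: "real \<Rightarrow> real"
  assumes S: "interval_family a b S" and q: "q integrable_on {a..b}" "\<And>x. x \<in> {a..b} \<Longrightarrow> 0 \<le> q x"
  shows "(\<Sum>(x, y)\<in>S. integral {x..y} q) \<le> integral {a..b} q"
proof -
  define I where "I p = {fst p<..<snd p}" for p :: "real \<times> real"
  have fin: "finite S" and sub: "\<And>p. p \<in> S \<Longrightarrow> a \<le> fst p \<and> fst p \<le> snd p \<and> snd p \<le> b"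
    and sep: "\<And>p r. p \<in> S \<Longrightarrow> r \<in> S \<Longrightarrow> p \<noteq> r \<Longrightarrow> snd p \<le> fst r \<or> snd r \<le> fst p"
    using S by (auto simp: interval_family_def)
  have I_int: "I p \<inter> {a..b} = I p" if "p \<in> S" for p
    using sub[OF that] by (auto simp: I_def)
  have int: "(\<lambda>t. if t \<in> I p then q t else 0) integrable_on {a..b}" if "p \<in> S" for p
    unfolding integrable_restrict_Int I_int[OF that] unfolding I_def
    using integrable_on_subset_Icc[OF q(1), of "fst p" "snd p"] sub[OF that]
    by (simp add: integrable_on_Icc_iff_Ioo)
  have "(\<Sum>(x, y)\<in>S. integral {x..y} q) = (\<Sum>p\<in>S. integral {a..b} (\<lambda>t. if t \<in> I p then q t else 0))"
  proof (intro sum.cong refl)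
    fix p assume p: "p \<in> S"
    show "(case p of (x, y) \<Rightarrow> integral {x..y} q) = integral {a..b} (\<lambda>t. if t \<in> I p then q t else 0)"
      unfolding integral_restrict_Int I_int[OF p] unfolding I_def
      by (simp add: case_prod_unfold integral_open_interval_real)
  qed
  also have "\<dots> = integral {a..b} (\<lambda>t. \<Sum>p\<in>S. if t \<in> I p then q t else 0)"
    by (intro integral_sum[symmetric] fin int)
  also have "\<dots> \<le> integral {a..b} q"
  proof (intro integral_le integrable_sum fin int q)
    fix t assume t: "t \<in> {a..b}"
    have "(\<Sum>p\<in>S. if t \<in> I p then q t else 0) = real (card {p \<in> S. t \<in> I p}) * q t"
      using fin by (simp add: sum.If_cases Int_def)
    also have "card {p \<in> S. t \<in> I p} \<le> Suc 0"
    proof (subst card_le_Suc0_iff_eq)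
      show "\<forall>p\<in>{p \<in> S. t \<in> I p}. \<forall>r\<in>{p \<in> S. t \<in> I p}. p = r"
      proof (intro ballI, rule ccontr)
        fix p r assume "p \<in> {p \<in> S. t \<in> I p}" "r \<in> {p \<in> S. t \<in> I p}" "p \<noteq> r"
        then show False
          using sep[of p r] by (auto simp: I_def)
      qed
    qed (use fin in auto)
    then have "real (card {p \<in> S. t \<in> I p}) * q t \<le> 1 * q t"
      using q(2)[OF t] by (intro mult_right_mono) auto
    finally show "(\<Sum>p\<in>S. if t \<in> I p then q t else 0) \<le> q t"
      by simp
  qed
  finally show ?thesis .
qed

text \<open>Absolute continuity of the integral: choose \<open>n\<close> so that the part of
  \<open>q\<close> above height \<open>n\<close> has integral below \<open>e / 2\<close>; the
  bounded part contributes at most \<open>n + 1\<close> times the total length. This dictates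
  \<open>\<eta> = e / (2 * (n + 1))\<close>, where \<open>n + 1\<close> is positive even for
  \<open>n = 0\<close>.\<close>

lemma sum_integral_small:
  fixes q :: "real \<Rightarrow> real"
  assumes q: "q integrable_on {a..b}" "\<And>x. x \<in> {a..b} \<Longrightarrow> 0 \<le> q x" and "e > 0"
  obtains \<eta> where "\<eta> > 0"
    "\<And>S. interval_family a b S \<Longrightarrow> (\<Sum>(x, y)\<in>S. y - x) < \<eta> \<Longrightarrow> (\<Sum>(x, y)\<in>S. integral {x..y} q) < e"
proof -
  have "\<forall>\<^sub>F n in sequentially. integral {a..b} q - e / 2 < integral {a..b} (\<lambda>x. min (q x) (real n))"
    using order_tendstoD(1)[OF integral_min_const_tendsto[OF q]] \<open>e > 0\<close> by simp
  then obtain n where n: "integral {a..b} q - e / 2 < integral {a..b} (\<lambda>x. min (q x) (real n))"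
    by (auto simp: eventually_sequentially)
  let ?q = "\<lambda>x. min (q x) (real n)"
  have "?q integrable_on {a..b}"
    by (rule integrable_on_min_const[OF q])
  then have int: "?q integrable_on {a..b}" "(\<lambda>x. q x - ?q x) integrable_on {a..b}"
    using q(1) by (auto intro: integrable_diff)
  have "(\<Sum>(x, y)\<in>S. integral {x..y} q) < e"
    if S: "interval_family a b S" and small: "(\<Sum>(x, y)\<in>S. y - x) < e / (2 * (real n + 1))" for S
  proof -
    have "(\<Sum>(x, y)\<in>S. integral {x..y} q) \<le> (\<Sum>(x, y)\<in>S. integral {x..y} (\<lambda>x. q x - ?q x) + (real n + 1) * (y - x))"
    proof (intro sum_mono, clarify)
      fix x y assume "(x, y) \<in> S"
      then have xy: "a \<le> x" "x \<le> y" "y \<le> b"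
        using S by (auto simp: interval_family_def)
      have "integral {x..y} q = integral {x..y} (\<lambda>x. q x - ?q x) + integral {x..y} ?q"
        using integral_diff[OF integrable_on_subset_Icc[OF q(1) xy(1,3)] integrable_on_subset_Icc[OF int(1) xy(1,3)]]
        by simp
      also have "integral {x..y} ?q \<le> integral {x..y} (\<lambda>_. real n + 1)"
        by (intro integral_le integrable_on_subset_Icc[OF int(1) xy(1,3)] integrable_const_ivl) auto
      also have "\<dots> = (real n + 1) * (y - x)"
        using xy by (simp add: mult.commute)
      finally show "integral {x..y} q \<le> integral {x..y} (\<lambda>x. q x - ?q x) + (real n + 1) * (y - x)"
        by simp
    qed
    also have "\<dots> = (\<Sum>(x, y)\<in>S. integral {x..y} (\<lambda>x. q x - ?q x)) + (real n + 1) * (\<Sum>(x, y)\<in>S. y - x)"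
      by (simp add: case_prod_unfold sum.distrib sum_distrib_left)
    also have "(\<Sum>(x, y)\<in>S. integral {x..y} (\<lambda>x. q x - ?q x)) \<le> integral {a..b} (\<lambda>x. q x - ?q x)"
      by (intro sum_integral_le S int) auto
    also have "integral {a..b} (\<lambda>x. q x - ?q x) < e / 2"
      using n integral_diff[OF q(1) int(1)] by simp
    also have "(real n + 1) * (\<Sum>(x, y)\<in>S. y - x) \<le> (real n + 1) * (e / (2 * (real n + 1)))"
      using small by (intro mult_left_mono) auto
    also have "\<dots> = e / 2"
      by (simp add: divide_simps)
    finally show ?thesis by simp
  qed
  then show ?thesis
    using \<open>e > 0\<close> by (intro that[of "e / (2 * (real n + 1))"]) auto
qed

text \<open>The primitives are nondecreasing, so each absolute increment is simply the integral over
  its interval.\<close>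

lemma equiabs_continuous_integral_iff:
  fixes h :: "nat \<Rightarrow> real \<Rightarrow> real"
  assumes h: "\<And>n. h n integrable_on {a..b}" "\<And>n x. x \<in> {a..b} \<Longrightarrow> 0 \<le> h n x"
  shows "equiabs_continuous (\<lambda>n x. integral {a..x} (h n)) a b \<longleftrightarrow>
    (\<forall>\<epsilon>>0. \<exists>\<eta>>0. \<forall>S. interval_family a b S \<longrightarrow>
     (\<Sum>(x, y)\<in>S. y - x) < \<eta> \<longrightarrow> (\<forall>n. (\<Sum>(x, y)\<in>S. integral {x..y} (h n)) < \<epsilon>))"
proof -
  have "(\<Sum>(x, y)\<in>S. \<bar>integral {a..y} (h n) - integral {a..x} (h n)\<bar>) = (\<Sum>(x, y)\<in>S. integral {x..y} (h n))"
    if S: "interval_family a b S" for S n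
  proof (intro sum.cong refl, clarify)
    fix x y assume "(x, y) \<in> S"
    then have xy: "a \<le> x" "x \<le> y" "y \<le> b"
      using S by (auto simp: interval_family_def)
    have "0 \<le> integral {x..y} (h n)"
      using xy by (intro Henstock_Kurzweil_Integration.integral_nonneg integrable_on_subset_Icc[OF h(1)] h(2)) auto
    then show "\<bar>integral {a..y} (h n) - integral {a..x} (h n)\<bar> = integral {x..y} (h n)"
      using integral_diff_Icc[OF h(1) xy, of n] by simp
  qed
  then show ?thesis
    unfolding equiabs_continuous_iff by simp
qed

lemma equiabs_continuous_integralI:
  fixes h :: "nat \<Rightarrow> real \<Rightarrow> real"
  assumes "\<And>n. h n integrable_on {a..b}" "\<And>n x. x \<in> {a..b} \<Longrightarrow> 0 \<le> h n x"
    and "\<And>\<epsilon>. \<epsilon> > 0 \<Longrightarrow> \<exists>\<eta>>0. \<forall>S. interval_family a b S \<longrightarrow> (\<Sum>(x, y)\<in>S. y - x) < \<eta> \<longrightarrow>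
      (\<forall>n. (\<Sum>(x, y)\<in>S. integral {x..y} (h n)) < \<epsilon>)"
  shows "equiabs_continuous (\<lambda>n x. integral {a..x} (h n)) a b"
proof (rule iffD2[OF equiabs_continuous_integral_iff])
  show "h n integrable_on {a..b}" for n
    by (rule assms(1))
  show "0 \<le> h n x" if "x \<in> {a..b}" for n x
    by (rule assms(2)[OF that])
qed (intro allI impI assms(3))

lemma equiabs_continuous_integralE:
  fixes h :: "nat \<Rightarrow> real \<Rightarrow> real"
  assumes "\<And>n. h n integrable_on {a..b}" "\<And>n x. x \<in> {a..b} \<Longrightarrow> 0 \<le> h n x"
    and "equiabs_continuous (\<lambda>n x. integral {a..x} (h n)) a b" "\<epsilon> > 0"
  obtains \<eta> where "\<eta> > 0" "\<And>S n. interval_family a b S \<Longrightarrow> (\<Sum>(x, y)\<in>S. y - x) < \<eta> \<Longrightarrow>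
      (\<Sum>(x, y)\<in>S. integral {x..y} (h n)) < \<epsilon>"
proof -
  have "\<forall>\<epsilon>>0. \<exists>\<eta>>0. \<forall>S. interval_family a b S \<longrightarrow> (\<Sum>(x, y)\<in>S. y - x) < \<eta> \<longrightarrow>
      (\<forall>n. (\<Sum>(x, y)\<in>S. integral {x..y} (h n)) < \<epsilon>)"
  proof (rule iffD1[OF equiabs_continuous_integral_iff assms(3)])
    show "h n integrable_on {a..b}" for n
      by (rule assms(1))
    show "0 \<le> h n x" if "x \<in> {a..b}" for n x
      by (rule assms(2)[OF that])
  qed
  then show ?thesis
    using that \<open>\<epsilon> > 0\<close> by meson
qed

section \<open>From convergence of the integrals to equi-absolute continuity\<close>

lemma integral_min_tendsto:
  fixes h :: "nat \<Rightarrow> real \<Rightarrow> real" and k :: "real \<Rightarrow> real"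
  assumes h: "\<And>n. h n integrable_on {a..b}" "\<And>n x. x \<in> {a..b} \<Longrightarrow> 0 \<le> h n x"
    and k: "k integrable_on {a..b}" and lim: "\<And>x. x \<in> {a..b} \<Longrightarrow> (\<lambda>n. h n x) \<longlonglongrightarrow> k x"
  shows "(\<lambda>x. min (h n x) (k x)) integrable_on {a..b}"
    and "(\<lambda>n. integral {a..b} (\<lambda>x. min (h n x) (k x))) \<longlonglongrightarrow> integral {a..b} k"
proof -
  have k_pos: "0 \<le> k x" if "x \<in> {a..b}" for x
    using lim[OF that] h(2)[OF that] by (intro LIMSEQ_le_const) auto
  have "(\<lambda>x. min (h n x) (k x)) absolutely_integrable_on {a..b}" for n
    by (intro absolutely_integrable_min_1 nonnegative_absolutely_integrable_1 h k k_pos)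
  then show int: "(\<lambda>x. min (h n x) (k x)) integrable_on {a..b}" for n
    using set_lebesgue_integral_eq_integral(1) by blast
  show "(\<lambda>n. integral {a..b} (\<lambda>x. min (h n x) (k x))) \<longlonglongrightarrow> integral {a..b} k"
  proof (rule dominated_convergence(2)[OF int k])
    fix x assume x: "x \<in> {a..b}"
    show "norm (min (h n x) (k x)) \<le> k x" for n
      using h(2)[OF x, of n] k_pos[OF x] by auto
    have "(\<lambda>n. min (h n x) (k x)) \<longlonglongrightarrow> min (k x) (k x)"
      by (intro tendsto_min lim x tendsto_const)
    then show "(\<lambda>n. min (h n x) (k x)) \<longlonglongrightarrow> k x" by simp
  qed
qed

text \<open>Scheffe's argument: \<open>\<bar>h n - k\<bar> = h n + k - 2 min (h n) k\<close>, and the minimum is dominated by \<open>k\<close>.\<close>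

lemma tendsto_imp_equiabs_continuous:
  fixes h :: "nat \<Rightarrow> real \<Rightarrow> real" and k :: "real \<Rightarrow> real"
  assumes h: "\<And>n. h n integrable_on {a..b}" "\<And>n x. x \<in> {a..b} \<Longrightarrow> 0 \<le> h n x"
    and k: "k integrable_on {a..b}" and lim: "\<And>x. x \<in> {a..b} \<Longrightarrow> (\<lambda>n. h n x) \<longlonglongrightarrow> k x"
    and int_lim: "(\<lambda>n. integral {a..b} (h n)) \<longlonglongrightarrow> integral {a..b} k"
  shows "equiabs_continuous (\<lambda>n x. integral {a..x} (h n)) a b"
proof (rule equiabs_continuous_integralI[OF h])
  fix e :: real assume "e > 0"
  note min = integral_min_tendsto[where h = h and k = k, OF h k lim]
  have k_pos: "0 \<le> k x" if "x \<in> {a..b}" for x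
    using lim[OF that] h(2)[OF that] by (intro LIMSEQ_le_const) auto
  let ?d = "\<lambda>n x. h n x + k x - 2 * min (h n x) (k x)"
  have d_int: "?d n integrable_on {a..b}" for n
    by (intro integrable_diff integrable_add h k integrable_on_mult_right min)
  have d_eq: "integral {a..b} (?d n) = integral {a..b} (h n) + integral {a..b} k - 2 * integral {a..b} (\<lambda>x. min (h n x) (k x))" for n
    by (subst integral_diff) (auto intro!: integrable_add integrable_on_mult_right h k min simp: integral_add h k)
  have "(\<lambda>n. integral {a..b} (?d n)) \<longlonglongrightarrow> integral {a..b} k + integral {a..b} k - 2 * integral {a..b} k"
    unfolding d_eq by (intro tendsto_intros int_lim min)
  then have "\<forall>\<^sub>F n in sequentially. integral {a..b} (?d n) < e / 2"
    using \<open>e > 0\<close> by (intro order_tendstoD(2)[of _ 0]) auto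
  then obtain N where N: "\<And>n. n \<ge> N \<Longrightarrow> integral {a..b} (?d n) < e / 2"
    by (auto simp: eventually_sequentially)
  \<comment> \<open>One integrable majorant serves all indices: the sum dominates each
    \<open>h n\<close> with \<open>n < N\<close>, and \<open>k\<close> handles the later ones once
    the small error \<open>?d n\<close> is split off.\<close>
  let ?q = "\<lambda>x. k x + (\<Sum>n<N. h n x)"
  have q: "?q integrable_on {a..b}"
    by (intro integrable_add integrable_sum h k) auto
  have q_pos: "0 \<le> ?q x" if "x \<in> {a..b}" for x
    using that by (intro add_nonneg_nonneg sum_nonneg k_pos h)
  obtain \<eta> where \<eta>: "\<eta> > 0" "\<And>S. interval_family a b S \<Longrightarrow> (\<Sum>(x, y)\<in>S. y - x) < \<eta> \<Longrightarrow> (\<Sum>(x, y)\<in>S. integral {x..y} ?q) < e / 2"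
    using sum_integral_small[OF q q_pos, of "e / 2"] \<open>e > 0\<close> by auto
  have "(\<Sum>(x, y)\<in>S. integral {x..y} (h n)) < e"
    if S: "interval_family a b S" and small: "(\<Sum>(x, y)\<in>S. y - x) < \<eta>" for S n
  proof -
    have sub: "a \<le> x" "x \<le> y" "y \<le> b" if "(x, y) \<in> S" for x y
      using S that by (auto simp: interval_family_def)
    show ?thesis
    proof (cases "n < N")
      case True
      have "(\<Sum>(x, y)\<in>S. integral {x..y} (h n)) \<le> (\<Sum>(x, y)\<in>S. integral {x..y} ?q)"
      proof (intro sum_mono, clarify)
        fix x y assume xy: "(x, y) \<in> S"
        have le: "h n t \<le> ?q t" if "t \<in> {x..y}" for t
        proof -
          have t: "t \<in> {a..b}" using that sub[OF xy] by auto
          have "h n t \<le> (\<Sum>n<N. h n t)"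
            using True h(2)[OF t] by (intro member_le_sum) auto
          with k_pos[OF t] show ?thesis by simp
        qed
        show "integral {x..y} (h n) \<le> integral {x..y} ?q"
          using sub[OF xy] by (intro integral_le integrable_on_subset_Icc[OF h(1)] integrable_on_subset_Icc[OF q] le)
      qed
      also have "\<dots> < e / 2"
        using \<eta>(2)[OF S small] .
      finally show ?thesis using \<open>e > 0\<close> by simp
    next
      case False
      have "(\<Sum>(x, y)\<in>S. integral {x..y} (h n)) \<le> (\<Sum>(x, y)\<in>S. integral {x..y} (?d n) + integral {x..y} ?q)"
      proof (intro sum_mono, clarify)
        fix x y assume xy: "(x, y) \<in> S"
        note ints = integrable_on_subset_Icc[OF h(1)[of n], of x y] integrable_on_subset_Icc[OF q, of x y]
          integrable_on_subset_Icc[OF d_int[of n], of x y]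
        \<comment> \<open>\<open>?d n\<close> is \<open>\<bar>h n - k\<bar>\<close>, hence
          \<open>h n \<le> ?d n + k\<close>; the finite sum in \<open>?q\<close> only enlarges the
          right-hand side.\<close>
        have le: "h n t \<le> ?d n t + ?q t" if "t \<in> {x..y}" for t
        proof -
          have t: "t \<in> {a..b}" using that sub[OF xy] by auto
          have "0 \<le> (\<Sum>n<N. h n t)"
            using h(2)[OF t] by (intro sum_nonneg) auto
          with k_pos[OF t] show ?thesis by (auto simp: min_def)
        qed
        have "integral {x..y} (h n) \<le> integral {x..y} (\<lambda>t. ?d n t + ?q t)"
          using sub[OF xy] by (intro integral_le integrable_add ints le)
        also have "\<dots> = integral {x..y} (?d n) + integral {x..y} ?q"
          using sub[OF xy] by (intro integral_add ints)
        finally show "integral {x..y} (h n) \<le> integral {x..y} (?d n) + integral {x..y} ?q" .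
      qed
      also have "\<dots> = (\<Sum>(x, y)\<in>S. integral {x..y} (?d n)) + (\<Sum>(x, y)\<in>S. integral {x..y} ?q)"
        by (simp only: case_prod_unfold sum.distrib)
      also have "(\<Sum>(x, y)\<in>S. integral {x..y} (?d n)) \<le> integral {a..b} (?d n)"
        by (intro sum_integral_le S d_int) auto
      also have "\<dots> < e / 2"
        using N False by simp
      also have "(\<Sum>(x, y)\<in>S. integral {x..y} ?q) < e / 2"
        using \<eta>(2)[OF S small] .
      finally show ?thesis by simp
    qed
  qed
  with \<eta>(1) show "\<exists>\<eta>>0. \<forall>S. interval_family a b S \<longrightarrow> (\<Sum>(x, y)\<in>S. y - x) < \<eta> \<longrightarrow>
      (\<forall>n. (\<Sum>(x, y)\<in>S. integral {x..y} (h n)) < e)"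
    by blast
qed

section \<open>From equi-absolute continuity to convergence of the integrals\<close>

lemma integrable_on_indicator_mult:
  fixes q :: "real \<Rightarrow> real"
  assumes "E \<in> sets lebesgue" "q integrable_on {a..b}" "\<And>x. x \<in> {a..b} \<Longrightarrow> 0 \<le> q x"
  shows "(\<lambda>x. indicat_real E x * q x) integrable_on {a..b}"
proof -
  have "indicat_real E \<in> borel_measurable (lebesgue_on {a..b})"
    using assms(1) by (intro measurable_restrict_space1 borel_measurable_indicator)
  moreover have "{a..b} \<in> sets lebesgue"
    by simp
  moreover have "bounded (indicat_real E ` {a..b})"
    unfolding bounded_iff by (intro exI[of _ 1]) (auto simp: indicator_def)
  moreover have "q absolutely_integrable_on {a..b}"
    by (rule nonnegative_absolutely_integrable_1[OF assms(2,3)])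
  ultimately have "(\<lambda>x. indicat_real E x * q x) absolutely_integrable_on {a..b}"
    by (rule absolutely_integrable_bounded_measurable_product_real)
  then show ?thesis
    by (rule set_lebesgue_integral_eq_integral(1))
qed

text \<open>Two nondegenerate intervals, neither to the left of the other, share an open piece,
  against disjointness of the interiors. \<open>Inf\<close> and \<open>Sup\<close> recover the
  endpoints.\<close>

lemma interval_family_cboxes:
  fixes D :: "real set set"
  assumes D: "finite D" "\<And>K. K \<in> D \<Longrightarrow> K \<subseteq> {a..b} \<and> (\<exists>c d. K = {c..d} \<and> c < d)"
    and disj: "pairwise (\<lambda>A B. interior A \<inter> interior B = {}) D"
  shows "interval_family a b ((\<lambda>K. (Inf K, Sup K)) ` D)"
proof -
  have K: "K = {Inf K..Sup K}" "Inf K < Sup K" "a \<le> Inf K" "Sup K \<le> b" if K: "K \<in> D" for K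
    using D(2)[OF K] by auto
  have "Sup K \<le> Inf L \<or> Sup L \<le> Inf K" if KL: "K \<in> D" "L \<in> D" "K \<noteq> L" for K L
  proof (rule ccontr)
    assume "\<not> (Sup K \<le> Inf L \<or> Sup L \<le> Inf K)"
    then have "max (Inf K) (Inf L) < min (Sup K) (Sup L)"
      using K(2)[OF KL(1)] K(2)[OF KL(2)] by auto
    then obtain m where "max (Inf K) (Inf L) < m" "m < min (Sup K) (Sup L)"
      using dense by blast
    then have "m \<in> interior {Inf K..Sup K}" "m \<in> interior {Inf L..Sup L}"
      by auto
    then show False
      using disj KL K(1)[OF KL(1)] K(1)[OF KL(2)] unfolding pairwise_def by auto
  qed
  moreover have "finite ((\<lambda>K. (Inf K, Sup K)) ` D)"
    using D(1) by simp
  moreover have "a \<le> fst p \<and> fst p \<le> snd p \<and> snd p \<le> b" if "p \<in> (\<lambda>K. (Inf K, Sup K)) ` D" for p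
    using that K(2,3,4) by (auto simp: less_imp_le)
  ultimately show ?thesis
    unfolding interval_family_def by (auto simp: case_prod_unfold)
qed

lemma integral_Union_le_sum:
  fixes q :: "real \<Rightarrow> real"
  assumes S: "interval_family a b S" and q: "q integrable_on {a..b}" "\<And>x. x \<in> {a..b} \<Longrightarrow> 0 \<le> q x"
    and E: "E \<in> sets lebesgue" "E \<subseteq> (\<Union>(x, y)\<in>S. {x..y})"
  shows "integral {a..b} (\<lambda>t. indicat_real E t * q t) \<le> (\<Sum>(x, y)\<in>S. integral {x..y} q)"
proof -
  have fin: "finite S" and sub: "\<And>p. p \<in> S \<Longrightarrow> a \<le> fst p \<and> snd p \<le> b"
    using S by (auto simp: interval_family_def)
  have Int: "{fst p..snd p} \<inter> {a..b} = {fst p..snd p}" if "p \<in> S" for p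
    using sub[OF that] by auto
  have int: "(\<lambda>t. if t \<in> {fst p..snd p} then q t else 0) integrable_on {a..b}" if "p \<in> S" for p
    unfolding integrable_restrict_Int Int[OF that]
    using integrable_on_subset_Icc[OF q(1)] sub[OF that] by blast
  have "integral {a..b} (\<lambda>t. indicat_real E t * q t)
      \<le> integral {a..b} (\<lambda>t. \<Sum>p\<in>S. if t \<in> {fst p..snd p} then q t else 0)"
  proof (intro integral_le integrable_on_indicator_mult integrable_sum E q fin int)
    fix t assume t: "t \<in> {a..b}"
    have nonneg: "0 \<le> (if t \<in> {fst p..snd p} then q t else 0)" for p
      using q(2)[OF t] by simp
    show "indicat_real E t * q t \<le> (\<Sum>p\<in>S. if t \<in> {fst p..snd p} then q t else 0)"
    proof (cases "t \<in> E")
      case True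
      then obtain p where p: "p \<in> S" "t \<in> {fst p..snd p}"
        using E(2) by fastforce
      then have "q t \<le> (\<Sum>p\<in>S. if t \<in> {fst p..snd p} then q t else 0)"
        using member_le_sum[of p S "\<lambda>p. if t \<in> {fst p..snd p} then q t else 0"] nonneg fin by simp
      with True show ?thesis by simp
    qed (simp add: sum_nonneg nonneg del: atLeastAtMost_iff)
  qed
  also have "\<dots> = (\<Sum>p\<in>S. integral {a..b} (\<lambda>t. if t \<in> {fst p..snd p} then q t else 0))"
    by (intro integral_sum fin int)
  also have "\<dots> = (\<Sum>p\<in>S. integral {fst p..snd p} q)"
    by (intro sum.cong refl) (simp only: integral_restrict_Int Int)
  finally show ?thesis
    by (simp add: case_prod_unfold)
qed

text \<open>Passage from finite interval families to measurable sets: \<open>E\<close> is covered by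
  countably many nonoverlapping intervals of total length below \<open>\<eta>\<close>. Finitely many
  of them form an admissible family, which bounds the integral over the part of \<open>E\<close>
  they cover; dominated convergence exhausts \<open>E\<close> and turns \<open><\<close> into
  \<open>\<le>\<close>.\<close>

lemma equiabs_continuous_small_sets:
  fixes h :: "nat \<Rightarrow> real \<Rightarrow> real"
  assumes h: "\<And>n. h n integrable_on {a..b}" "\<And>n x. x \<in> {a..b} \<Longrightarrow> 0 \<le> h n x"
    and eq: "equiabs_continuous (\<lambda>n x. integral {a..x} (h n)) a b" and "a < b" "e > 0"
  obtains \<eta> where "\<eta> > 0"
    "\<And>E n. E \<in> lmeasurable \<Longrightarrow> E \<subseteq> {a..b} \<Longrightarrow> measure lebesgue E < \<eta> \<Longrightarrow>
       integral {a..b} (\<lambda>x. indicat_real E x * h n x) \<le> e"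
proof -
  obtain \<eta> where \<eta>: "\<eta> > 0" "\<And>S n. interval_family a b S \<Longrightarrow> (\<Sum>(x, y)\<in>S. y - x) < \<eta> \<Longrightarrow>
      (\<Sum>(x, y)\<in>S. integral {x..y} (h n)) < e"
    using equiabs_continuous_integralE[OF h eq \<open>e > 0\<close>] by blast
  have "integral {a..b} (\<lambda>x. indicat_real E x * h n x) \<le> e"
    if E: "E \<in> lmeasurable" "E \<subseteq> {a..b}" "measure lebesgue E < \<eta>" for E n
  proof -
    \<comment> \<open>Half of the slack \<open>\<eta> - measure lebesgue E\<close> is allowed as
      excess, so the cover itself still measures less than \<open>\<eta>\<close>.\<close>
    have E_cbox: "E \<subseteq> cbox a b" and E_pos: "(\<eta> - measure lebesgue E) / 2 > 0"
      using E by auto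
    have "\<exists>D. countable D \<and> (\<forall>K\<in>D. K \<subseteq> cbox a b \<and> (\<exists>c d. K = cbox c d)) \<and>
        pairwise (\<lambda>A B. interior A \<inter> interior B = {}) D \<and> (\<forall>K\<in>D. box a b \<noteq> {} \<longrightarrow> interior K \<noteq> {}) \<and>
        E \<subseteq> \<Union>D \<and> \<Union>D \<in> lmeasurable \<and> measure lebesgue (\<Union>D) \<le> measure lebesgue E + (\<eta> - measure lebesgue E) / 2"
      by (rule measurable_outer_intervals_bounded[OF E(1) E_cbox E_pos]) (rule exI, intro conjI ballI impI; simp)
    then obtain D where D: "countable D"
      "\<forall>K\<in>D. K \<subseteq> cbox a b \<and> (\<exists>c d. K = cbox c d)"
      "pairwise (\<lambda>A B. interior A \<inter> interior B = {}) D"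
      "\<forall>K\<in>D. box a b \<noteq> {} \<longrightarrow> interior K \<noteq> {}"
      "E \<subseteq> \<Union>D" "\<Union>D \<in> lmeasurable" "measure lebesgue (\<Union>D) \<le> measure lebesgue E + (\<eta> - measure lebesgue E) / 2"
      by (elim exE conjE) (rule that; assumption)
    have m_D: "measure lebesgue (\<Union>D) < \<eta>"
      using D(7) E(3) by (simp add: field_simps)
    have D': "K \<subseteq> {a..b} \<and> (\<exists>c d. K = {c..d} \<and> c < d)" if K: "K \<in> D" for K
    proof -
      obtain c d where cd: "K = {c..d}" using bspec[OF D(2) K] by auto
      have "interior K \<noteq> {}" using bspec[OF D(4) K] \<open>a < b\<close> by simp
      then have "c < d" using cd by simp
      with cd bspec[OF D(2) K] show ?thesis by auto
    qed
    show ?thesis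
    proof (cases "D = {}")
      case True
      then show ?thesis using D(5) \<open>e > 0\<close> by simp
    next
      case False
      \<comment> \<open>For finite \<open>D\<close> this enumeration repeats elements, harmlessly:
        the families below are images, in which a repeated interval counts once.\<close>
      define K where "K = from_nat_into D"
      have K: "K i \<in> D" for i
        unfolding K_def using False by (rule from_nat_into)
      have range_K: "range K = D"
        unfolding K_def using False D(1) by (rule range_from_nat_into)
      let ?E = "\<lambda>N. E \<inter> (\<Union>i<N. K i)"
      have K_sets: "K i \<in> sets lebesgue" for i
        using D'[OF K[of i]] by auto
      have E_sets: "?E N \<in> sets lebesgue" for N
        using E(1) K_sets by auto
      have le: "integral {a..b} (\<lambda>x. indicat_real (?E N) x * h n x) \<le> e" for N
      proof -
        let ?S = "(\<lambda>K. (Inf K, Sup K)) ` (K ` {..<N})"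
        have S: "interval_family a b ?S"
          using D' K D(3) by (intro interval_family_cboxes) (auto simp: pairwise_def)
        have mem: "{x..y} \<in> D" "x < y" if xy: "(x, y) \<in> ?S" for x y
        proof -
          obtain i where i: "(x, y) = (Inf (K i), Sup (K i))" using xy by auto
          obtain c d where "K i = {c..d}" "c < d" using D'[OF K[of i]] by blast
          with i K[of i] show "{x..y} \<in> D" "x < y" by auto
        qed
        \<comment> \<open>Each length is written as an integral of the indicator of the whole cover,
          so \<open>sum_integral_le\<close> compares the total length with the measure of the
          cover.\<close>
        have "(\<Sum>(x, y)\<in>?S. y - x) = (\<Sum>(x, y)\<in>?S. integral {x..y} (indicat_real (\<Union>D)))"
        proof (intro sum.cong refl)
          fix p assume "p \<in> ?S"
          moreover obtain x y where p: "p = (x, y)"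
            by fastforce
          ultimately have xy: "{x..y} \<in> D" "x < y"
            using mem by blast+
          have "indicat_real (\<Union>D) t = 1" if "t \<in> {x..y}" for t
            using UnionI[OF xy(1) that] by simp
          then have "integral {x..y} (indicat_real (\<Union>D)) = integral {x..y} (\<lambda>_. 1)"
            by (rule integral_cong)
          then show "(case p of (x, y) \<Rightarrow> y - x) = (case p of (x, y) \<Rightarrow> integral {x..y} (indicat_real (\<Union>D)))"
            using xy by (simp add: p)
        qed
        also have "\<dots> \<le> integral {a..b} (indicat_real (\<Union>D))"
          using D(6) by (intro sum_integral_le S) (auto simp: integrable_on_indicator fmeasurable.Int)
        also have "\<dots> = measure lebesgue (\<Union>D \<inter> {a..b})"
          using D(6) by (intro Equivalence_Lebesgue_Henstock_Integration.integral_indicator) auto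
        also have "\<Union>D \<inter> {a..b} = \<Union>D"
          using D' by auto
        finally have "(\<Sum>(x, y)\<in>?S. y - x) < \<eta>"
          using m_D by simp
        then have less: "(\<Sum>(x, y)\<in>?S. integral {x..y} (h n)) < e"
          by (rule \<eta>(2)[OF S])
        have sub: "?E N \<subseteq> (\<Union>(x, y)\<in>?S. {x..y})"
        proof
          fix t assume "t \<in> ?E N"
          then obtain i where i: "i < N" "t \<in> K i" by auto
          obtain c d where "K i = {c..d}" "c < d" using D'[OF K[of i]] by blast
          with i have "t \<in> {Inf (K i)..Sup (K i)}" by simp
          with i show "t \<in> (\<Union>(x, y)\<in>?S. {x..y})" by blast
        qed
        have "integral {a..b} (\<lambda>x. indicat_real (?E N) x * h n x) \<le> (\<Sum>(x, y)\<in>?S. integral {x..y} (h n))"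
          by (intro integral_Union_le_sum[OF S] h E_sets sub)
        with less show ?thesis
          by linarith
      qed
      have "(\<lambda>N. integral {a..b} (\<lambda>x. indicat_real (?E N) x * h n x)) \<longlonglongrightarrow> integral {a..b} (\<lambda>x. indicat_real E x * h n x)"
      proof (rule dominated_convergence(2)[OF integrable_on_indicator_mult[OF E_sets h] h(1)[of n]])
        fix x assume x: "x \<in> {a..b}"
        show "norm (indicat_real (?E N) x * h n x) \<le> h n x" for N
          using h(2)[OF x, of n] by (simp add: indicator_def)
        show "(\<lambda>N. indicat_real (?E N) x * h n x) \<longlonglongrightarrow> indicat_real E x * h n x"
        proof (cases "x \<in> E")
          case True
          then obtain i where "x \<in> K i"
            using D(5) range_K by blast
          then have "indicat_real (?E N) x * h n x = indicat_real E x * h n x" if "N \<ge> Suc i" for N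
            using that True by (auto simp: indicator_def)
          then show ?thesis
            by (intro tendsto_eventually eventually_sequentiallyI[of "Suc i"])
        qed simp
      qed
      then show ?thesis
        using le by (intro LIMSEQ_le_const2) auto
    qed
  qed
  with \<eta>(1) show ?thesis
    using that by blast
qed

text \<open>Cut \<open>[a,b]\<close> into \<open>m\<close> intervals shorter than the
  \<open>\<eta>\<close> belonging to \<open>\<epsilon> = 1\<close>: each carries less than 1 of
  every \<open>h n\<close>, so \<open>B = m\<close> works.\<close>

lemma equiabs_continuous_bounded:
  fixes h :: "nat \<Rightarrow> real \<Rightarrow> real"
  assumes h: "\<And>n. h n integrable_on {a..b}" "\<And>n x. x \<in> {a..b} \<Longrightarrow> 0 \<le> h n x"
    and eq: "equiabs_continuous (\<lambda>n x. integral {a..x} (h n)) a b" and "a < b"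
  obtains B where "\<And>n. integral {a..b} (h n) \<le> B"
proof -
  obtain \<eta> where \<eta>: "\<eta> > 0" "\<And>S n. interval_family a b S \<Longrightarrow> (\<Sum>(x, y)\<in>S. y - x) < \<eta> \<Longrightarrow>
      (\<Sum>(x, y)\<in>S. integral {x..y} (h n)) < 1"
    using equiabs_continuous_integralE[OF h eq zero_less_one] by blast
  obtain m :: nat where m: "(b - a) / \<eta> < real m"
    using reals_Archimedean2 by blast
  then have "0 < real m"
    using \<open>a < b\<close> \<open>\<eta> > 0\<close> by (intro le_less_trans[OF _ m]) simp
  define w where "w = (b - a) / real m"
  have w: "w > 0" "w < \<eta>" "real m * w = b - a"
    using m \<open>0 < real m\<close> \<open>a < b\<close> \<open>\<eta> > 0\<close> by (auto simp: w_def field_simps)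
  have "integral {a..a + real i * w} (h n) \<le> real i" if "i \<le> m" for i n
    using that
  proof (induction i)
    case (Suc i)
    let ?x = "a + real i * w" and ?y = "a + real (Suc i) * w"
    have "real (Suc i) * w \<le> real m * w"
      using Suc.prems w by (intro mult_right_mono) auto
    then have xy: "a \<le> ?x" "?x \<le> ?y" "?y \<le> b"
      using w by (auto simp: algebra_simps)
    have "interval_family a b {(?x, ?y)}"
      using xy by (simp add: interval_family_def)
    from \<eta>(2)[OF this, of n] have "integral {?x..?y} (h n) < 1"
      using w by (simp add: algebra_simps)
    moreover have "integral {a..?x} (h n) \<le> real i"
      using Suc by simp
    ultimately show ?case
      using integral_diff_Icc[OF h(1)[of n] xy] by simp
  qed simp
  from this[of m] show ?thesis
    using w that[of "real m"] by simp
qed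

text \<open>At a fixed height \<open>j\<close> the constant \<open>j\<close> dominates, so the
  truncated limits have integrals at most \<open>B\<close>; monotone convergence in \<open>j\<close>
  removes the truncation.\<close>

lemma integrable_on_limit_bounded:
  fixes h :: "nat \<Rightarrow> real \<Rightarrow> real" and k :: "real \<Rightarrow> real"
  assumes h: "\<And>n. h n integrable_on {a..b}" "\<And>n x. x \<in> {a..b} \<Longrightarrow> 0 \<le> h n x"
    and lim: "\<And>x. x \<in> {a..b} \<Longrightarrow> (\<lambda>n. h n x) \<longlonglongrightarrow> k x"
    and B: "\<And>n. integral {a..b} (h n) \<le> B"
  shows "k integrable_on {a..b}"
proof -
  have k_pos: "0 \<le> k x" if "x \<in> {a..b}" for x
    using lim[OF that] h(2)[OF that] by (intro LIMSEQ_le_const) auto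
  have min_int: "(\<lambda>x. min (h n x) (real j)) integrable_on {a..b}" for n j
    by (rule integrable_on_min_const[OF h])
  have dom: "norm (min (h n x) (real j)) \<le> real j" if "x \<in> {a..b}" for n x j
    using h(2)[OF that, of n] by simp
  have conv: "(\<lambda>n. min (h n x) (real j)) \<longlonglongrightarrow> min (k x) (real j)" if "x \<in> {a..b}" for x j
    by (intro tendsto_min lim that tendsto_const)
  have min_k_int: "(\<lambda>x. min (k x) (real j)) integrable_on {a..b}" for j
    by (rule dominated_convergence(1)[OF min_int integrable_const_ivl dom conv])
  have min_k_lim: "(\<lambda>n. integral {a..b} (\<lambda>x. min (h n x) (real j))) \<longlonglongrightarrow> integral {a..b} (\<lambda>x. min (k x) (real j))" for j
    by (rule dominated_convergence(2)[OF min_int integrable_const_ivl dom conv])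
  have le_B: "integral {a..b} (\<lambda>x. min (k x) (real j)) \<le> B" for j
  proof (rule LIMSEQ_le_const2[OF min_k_lim], intro exI allI impI)
    fix n
    have "integral {a..b} (\<lambda>x. min (h n x) (real j)) \<le> integral {a..b} (h n)"
      by (intro integral_le min_int h) auto
    with B[of n] show "integral {a..b} (\<lambda>x. min (h n x) (real j)) \<le> B" by simp
  qed
  have ge_0: "0 \<le> integral {a..b} (\<lambda>x. min (k x) (real j))" for j
    by (intro Henstock_Kurzweil_Integration.integral_nonneg min_k_int) (use k_pos in auto)
  have "bounded (range (\<lambda>j. integral {a..b} (\<lambda>x. min (k x) (real j))))"
    unfolding bounded_iff using le_B ge_0 by (intro exI[of _ B]) auto
  moreover have "(\<lambda>j. min (k x) (real j)) \<longlonglongrightarrow> k x" for x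
  proof -
    obtain J where "k x \<le> real J"
      using real_arch_simple by blast
    then show ?thesis
      by (intro tendsto_eventually eventually_sequentiallyI[of J]) auto
  qed
  ultimately show ?thesis
    using monotone_convergence_increasing[of "\<lambda>j x. min (k x) (real j)" "{a..b}" k] min_k_int by auto
qed

text \<open>At each point the exceedance stops from some index on, so the indicators tend to 0
  pointwise, dominated by 1 on an interval of finite length.\<close>

lemma measure_exceedance_tendsto_0:
  fixes h :: "nat \<Rightarrow> real \<Rightarrow> real" and k :: "real \<Rightarrow> real"
  assumes h: "\<And>n. h n integrable_on {a..b}" and k: "k integrable_on {a..b}"
    and lim: "\<And>x. x \<in> {a..b} \<Longrightarrow> (\<lambda>n. h n x) \<longlonglongrightarrow> k x" and "d > 0"
  shows "{x \<in> {a..b}. k x + d < h n x} \<in> lmeasurable"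
    and "(\<lambda>n. measure lebesgue {x \<in> {a..b}. k x + d < h n x}) \<longlonglongrightarrow> 0"
proof -
  let ?G = "\<lambda>n. {x \<in> {a..b}. k x + d < h n x}"
  show G: "?G n \<in> lmeasurable" for n
  proof -
    have [measurable]: "h n \<in> borel_measurable (lebesgue_on {a..b})" "k \<in> borel_measurable (lebesgue_on {a..b})"
      by (intro integrable_imp_measurable h k)+
    have "{x \<in> space (lebesgue_on {a..b}). k x + d < h n x} \<in> sets (lebesgue_on {a..b})"
      by measurable
    then have "?G n \<in> sets lebesgue"
      by (simp add: sets_restrict_space_iff)
    then show ?thesis
    proof (rule fmeasurableI2[rotated 2])
      show "{a..b} \<in> lmeasurable" by simp
      show "?G n \<subseteq> {a..b}" by blast
    qed
  qed
  have G_Int: "?G n \<inter> {a..b} = ?G n" for n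
    by auto
  have "(\<lambda>n. integral {a..b} (indicat_real (?G n))) \<longlonglongrightarrow> integral {a..b} (\<lambda>_. 0)"
  proof (rule dominated_convergence(2))
    show "indicat_real (?G n) integrable_on {a..b}" for n
      unfolding integrable_on_indicator G_Int by (rule G)
    show "(\<lambda>_. 1 :: real) integrable_on {a..b}"
      by (rule integrable_const_ivl)
    show "norm (indicat_real (?G n) x) \<le> 1" for n x
      by (simp add: indicator_def)
    fix x assume x: "x \<in> {a..b}"
    have "\<forall>\<^sub>F n in sequentially. h n x < k x + d"
      using \<open>d > 0\<close> by (intro order_tendstoD(2)[OF lim[OF x]]) simp
    then show "(\<lambda>n. indicat_real (?G n) x) \<longlonglongrightarrow> 0"
      by (intro tendsto_eventually) (auto elim!: eventually_mono simp: indicator_def)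
  qed
  moreover have "integral {a..b} (indicat_real (?G n)) = measure lebesgue (?G n)" for n
    using Equivalence_Lebesgue_Henstock_Integration.integral_indicator[of "?G n" "{a..b}", unfolded G_Int, OF G] .
  ultimately show "(\<lambda>n. measure lebesgue (?G n)) \<longlonglongrightarrow> 0"
    by simp
qed

text \<open>The part of \<open>h n\<close> above the limit lives, up to a small constant, on sets whose
  measure tends to 0, where equi-absolute continuity makes its integral small.\<close>

lemma equiabs_continuous_imp_tendsto:
  fixes h :: "nat \<Rightarrow> real \<Rightarrow> real" and k :: "real \<Rightarrow> real"
  assumes h: "\<And>n. h n integrable_on {a..b}" "\<And>n x. x \<in> {a..b} \<Longrightarrow> 0 \<le> h n x"
    and lim: "\<And>x. x \<in> {a..b} \<Longrightarrow> (\<lambda>n. h n x) \<longlonglongrightarrow> k x"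
    and eq: "equiabs_continuous (\<lambda>n x. integral {a..x} (h n)) a b" and "a < b"
  shows "k integrable_on {a..b}"
    and "\<And>x. x \<in> {a..b} \<Longrightarrow> (\<lambda>n. integral {a..x} (h n)) \<longlonglongrightarrow> integral {a..x} k"
proof -
  obtain B where B: "\<And>n. integral {a..b} (h n) \<le> B"
    using equiabs_continuous_bounded[OF h eq \<open>a < b\<close>] by blast
  show k: "k integrable_on {a..b}"
    using integrable_on_limit_bounded[OF h lim B] by blast
  note min = integral_min_tendsto[where h = h and k = k, OF h k lim]
  let ?r = "\<lambda>n x. h n x - min (h n x) (k x)"
  have k_pos: "0 \<le> k x" if "x \<in> {a..b}" for x
    using lim[OF that] h(2)[OF that] by (intro LIMSEQ_le_const) auto
  have r_int: "?r n integrable_on {a..b}" for n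
    by (intro integrable_diff h min)
  have r_pos: "0 \<le> integral {x..y} (?r n)" if "a \<le> x" "y \<le> b" for n x y
    by (intro Henstock_Kurzweil_Integration.integral_nonneg integrable_on_subset_Icc[OF r_int that]) auto
  have r_lim: "(\<lambda>n. integral {a..b} (?r n)) \<longlonglongrightarrow> 0"
  proof (rule order_tendstoI)
    fix e :: real assume "0 < e"
    obtain \<eta> where \<eta>: "\<eta> > 0" "\<And>E n. E \<in> lmeasurable \<Longrightarrow> E \<subseteq> {a..b} \<Longrightarrow> measure lebesgue E < \<eta> \<Longrightarrow>
       integral {a..b} (\<lambda>x. indicat_real E x * h n x) \<le> e / 3"
      using equiabs_continuous_small_sets[OF h eq \<open>a < b\<close>, of "e / 3"] \<open>0 < e\<close> by auto
    \<comment> \<open>The constant \<open>d\<close> integrates to \<open>e / 3\<close>, and the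
      exceedance set adds at most \<open>e / 3\<close>; thirds leave room because the bound for
      small sets is not strict.\<close>
    define d where "d = e / (3 * (b - a))"
    have d: "d > 0" "d * (b - a) = e / 3"
      using \<open>a < b\<close> \<open>0 < e\<close> by (auto simp: d_def divide_simps)
    let ?G = "\<lambda>n. {x \<in> {a..b}. k x + d < h n x}"
    note G = measure_exceedance_tendsto_0[where h = h and k = k, OF h(1) k lim d(1)]
    have "\<forall>\<^sub>F n in sequentially. measure lebesgue (?G n) < \<eta>"
      using G(2) \<eta>(1) by (rule order_tendstoD(2))
    then show "\<forall>\<^sub>F n in sequentially. integral {a..b} (?r n) < e"
    proof eventually_elim
      case (elim n)
      have G_sets: "?G n \<in> sets lebesgue"
        using G(1)[of n] by blast
      have int: "(\<lambda>x. indicat_real (?G n) x * h n x) integrable_on {a..b}"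
        by (rule integrable_on_indicator_mult[OF G_sets h])
      have "integral {a..b} (?r n) \<le> integral {a..b} (\<lambda>x. d + indicat_real (?G n) x * h n x)"
      proof (intro integral_le integrable_add r_int int integrable_const_ivl)
        fix x assume x: "x \<in> {a..b}"
        \<comment> \<open>Outside \<open>?G n\<close> the excess is at most \<open>d\<close>;
          inside, it is at most \<open>h n x\<close> because \<open>k x \<ge> 0\<close>.\<close>
        show "?r n x \<le> d + indicat_real (?G n) x * h n x"
          using k_pos[OF x] h(2)[OF x, of n] d(1) x by (auto simp: indicator_def min_def)
      qed
      also have "\<dots> = d * (b - a) + integral {a..b} (\<lambda>x. indicat_real (?G n) x * h n x)"
        using \<open>a < b\<close> by (subst integral_add[OF integrable_const_ivl int]) (simp add: mult.commute)
      also have "integral {a..b} (\<lambda>x. indicat_real (?G n) x * h n x) \<le> e / 3"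
        by (rule \<eta>(2)[OF G(1) _ elim]) auto
      finally show ?case
        using \<open>0 < e\<close> d(2) by simp
    qed
  next
    fix e :: real assume "e < 0"
    then show "\<forall>\<^sub>F n in sequentially. e < integral {a..b} (?r n)"
      by (intro always_eventually allI less_le_trans[OF _ r_pos]) simp_all
  qed
  fix x assume x: "x \<in> {a..b}"
  then have x': "a \<le> x" "x \<le> b" by auto
  \<comment> \<open>Since \<open>?r n\<close> is nonnegative, its integral up to \<open>x\<close> is
    at most that up to \<open>b\<close>, so convergence over \<open>[a,b]\<close> settles every
    \<open>x\<close>.\<close>
  have "(\<lambda>n. integral {a..x} (?r n)) \<longlonglongrightarrow> 0"
  proof (rule tendsto_sandwich[OF _ _ tendsto_const r_lim])
    show "\<forall>\<^sub>F n in sequentially. 0 \<le> integral {a..x} (?r n)"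
      using r_pos x' by simp
    have "integral {a..x} (?r n) \<le> integral {a..b} (?r n)" for n
      using integral_diff_Icc[OF r_int[of n] x'(1,2) order_refl] r_pos[of x b n] x' by simp
    then show "\<forall>\<^sub>F n in sequentially. integral {a..x} (?r n) \<le> integral {a..b} (?r n)"
      by simp
  qed
  moreover have "(\<lambda>n. integral {a..x} (\<lambda>x. min (h n x) (k x))) \<longlonglongrightarrow> integral {a..x} k"
    using x' by (intro integral_min_tendsto(2) integrable_on_subset_Icc[OF h(1)] integrable_on_subset_Icc[OF k] h(2) lim) auto
  ultimately have "(\<lambda>n. integral {a..x} (?r n) + integral {a..x} (\<lambda>x. min (h n x) (k x))) \<longlonglongrightarrow> 0 + integral {a..x} k"
    by (rule tendsto_add)
  moreover have "integral {a..x} (?r n) + integral {a..x} (\<lambda>x. min (h n x) (k x)) = integral {a..x} (h n)" for n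
    by (subst integral_add[symmetric]) (use x' in \<open>auto intro: integrable_on_subset_Icc[OF r_int] integrable_on_subset_Icc[OF min(1)]\<close>)
  ultimately show "(\<lambda>n. integral {a..x} (h n)) \<longlonglongrightarrow> integral {a..x} k"
    by simp
qed

section \<open>Reduction of the theorem to nonnegative functions\<close>

text \<open>The correction \<open>max q 0 - q\<close> vanishes almost everywhere, so it is Lebesgue
  and hence Laplace integrable. Adding it to \<open>q\<close> gives a Laplace integrable function
  that is nonnegative at every point; its Lebesgue integrability passes back to \<open>q\<close>
  across the null set.\<close>

lemma laplace_integrable_AE_nonneg:
  assumes q: "laplace_integrable q a b" and AE: "AE x in lebesgue. x \<in> {a..b} \<longrightarrow> 0 \<le> q x" and "a \<le> b"
  shows "q absolutely_integrable_on {a..b}"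
proof -
  have N: "negligible {x. \<not> (x \<in> {a..b} \<longrightarrow> 0 \<le> q x)}" (is "negligible ?N")
    by (rule AE_lebesgue_imp_negligible[OF AE])
  let ?p = "\<lambda>x. max (q x) 0"
  have "(\<lambda>_. 0 :: real) absolutely_integrable_on {a..b}"
    using absolutely_integrable_on_const[of "{a..b}" "0 :: real"] by simp
  then have "(\<lambda>x. ?p x - q x) absolutely_integrable_on {a..b}"
    by (rule absolutely_integrable_spike[OF _ N]) auto
  then have "has_laplace_integral (\<lambda>x. ?p x - q x) a b (integral {a..b} (\<lambda>x. ?p x - q x))"
    using \<open>a \<le> b\<close> by (rule has_laplace_integral_absolutely_integrable)
  moreover have "has_laplace_integral q a b (laplace_integral q a b)"
    using q \<open>a \<le> b\<close> by (simp add: has_laplace_integral_iff)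
  ultimately have "has_laplace_integral (\<lambda>x. q x + (?p x - q x)) a b
      (laplace_integral q a b + integral {a..b} (\<lambda>x. ?p x - q x))"
    by (intro has_laplace_integral_add)
  then have "laplace_integrable ?p a b"
    using \<open>a \<le> b\<close> by (simp add: has_laplace_integral_iff)
  then have "?p integrable_on {a..b}"
    using \<open>a \<le> b\<close> by (intro laplace_integrable_nonneg_imp_integrable) auto
  then have "?p absolutely_integrable_on {a..b}"
    by (rule nonnegative_absolutely_integrable_1) auto
  then show ?thesis
    by (rule absolutely_integrable_spike[OF _ N]) auto
qed

theorem theorem7p1:
  fixes f :: "nat \<Rightarrow> real \<Rightarrow> real" and g F :: "real \<Rightarrow> real" and a b :: real
  assumes "a < b"
    and "\<And>n. laplace_integrable (f n) a b"
    and "laplace_integrable g a b"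
    and "\<And>n. AE x in lebesgue. x \<in> {a..b} \<longrightarrow> f n x \<ge> g x"
    and "AE x in lebesgue. x \<in> {a..b} \<longrightarrow> (\<lambda>n. f n x) \<longlonglongrightarrow> F x"
  shows "(laplace_integrable F a b \<and>
          (\<forall>x\<in>{a..b}. (\<lambda>n. laplace_integral (f n) a x) \<longlonglongrightarrow> laplace_integral F a x))
         \<longleftrightarrow> equiabs_continuous (\<lambda>n x. laplace_integral (\<lambda>t. f n t - g t) a x) a b"
proof -
  have ab: "a \<le> b" using \<open>a < b\<close> by simp
  have lap: "has_laplace_integral q a x (laplace_integral q a x)"
    if "laplace_integrable q a b" "x \<in> {a..b}" for q x
    using laplace_integrable_subinterval[OF that(1), of x] that(2) by (simp add: has_laplace_integral_iff)
  define h where "h n x = f n x - g x" for n x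
  define k where "k x = F x - g x" for x
  have h_lap: "laplace_integrable (h n) a b" for n
    using has_laplace_integral_diff[OF lap[OF assms(2)] lap[OF assms(3)], of b n] ab
    by (simp add: has_laplace_integral_iff h_def[abs_def])
  have h_AE: "AE x in lebesgue. x \<in> {a..b} \<longrightarrow> 0 \<le> h n x" for n
    using assms(4)[of n] by eventually_elim (simp add: h_def)
  have h_abs: "h n absolutely_integrable_on {a..b}" for n
    by (rule laplace_integrable_AE_nonneg[OF h_lap h_AE ab])
  have "AE x in lebesgue. \<forall>n. x \<in> {a..b} \<longrightarrow> 0 \<le> h n x"
    unfolding AE_all_countable using h_AE by blast
  then have AE: "AE x in lebesgue. x \<in> {a..b} \<longrightarrow> (\<forall>n. 0 \<le> h n x) \<and> (\<lambda>n. h n x) \<longlonglongrightarrow> k x"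
    using assms(5) by eventually_elim (auto simp: h_def k_def intro: tendsto_diff)
  \<comment> \<open>The exceptional sets of all \<open>n\<close> and of the convergence are merged
    into one null set. Setting \<open>h n\<close> and \<open>k\<close> to 0 on it makes
    nonnegativity and convergence hold everywhere on \<open>[a,b]\<close> and changes no
    integral.\<close>
  define N where "N = {x. \<not> (x \<in> {a..b} \<longrightarrow> (\<forall>n. 0 \<le> h n x) \<and> (\<lambda>n. h n x) \<longlonglongrightarrow> k x)}"
  have N: "negligible N"
    unfolding N_def by (rule AE_lebesgue_imp_negligible[OF AE])
  define h' where "h' n x = (if x \<in> N then 0 else h n x)" for n x
  define k' where "k' x = (if x \<in> N then 0 else k x)" for x
  have h': "0 \<le> h' n x" "(\<lambda>n. h' n x) \<longlonglongrightarrow> k' x" if "x \<in> {a..b}" for n x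
    using that by (auto simp: h'_def k'_def N_def)
  have h'_int: "h' n integrable_on {a..b}" for n
    using absolutely_integrable_spike[OF h_abs N, of "h' n"] set_lebesgue_integral_eq_integral(1)
    by (auto simp: h'_def)
  have int_h': "integral A (h' n) = integral A (h n)" for A n
    by (rule integral_spike[OF N]) (simp add: h'_def)
  have int_k': "integral A k' = integral A k" for A
    by (rule integral_spike[OF N]) (simp add: k'_def)
  have lap_abs: "has_laplace_integral q a x (integral {a..x} q)"
    if "q absolutely_integrable_on {a..b}" "x \<in> {a..b}" for q x
    using that by (intro has_laplace_integral_absolutely_integrable absolutely_integrable_on_subinterval[OF that(1)]) auto
  \<comment> \<open>Writing \<open>q = g + (q - g)\<close> brings back a summand outside the
    Lebesgue theory; with \<open>q = F\<close> it yields integrability of \<open>F\<close> from that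
    of \<open>k\<close>.\<close>
  have lap_shift: "has_laplace_integral q a x (laplace_integral g a x + integral {a..x} (\<lambda>x. q x - g x))"
    if "(\<lambda>x. q x - g x) absolutely_integrable_on {a..b}" "x \<in> {a..b}" for q x
    using has_laplace_integral_add[OF lap[OF assms(3) that(2)] lap_abs[OF that]] by simp
  have lap_h: "laplace_integral (\<lambda>t. f n t - g t) a x = integral {a..x} (h' n)" if "x \<in> {a..b}" for n x
    using lap_abs[OF h_abs that, of n] that by (simp add: has_laplace_integral_iff int_h' h_def[abs_def])
  have lap_f: "laplace_integral (f n) a x = laplace_integral g a x + integral {a..x} (h' n)" if "x \<in> {a..b}" for n x
    using lap_shift[of "f n" x] h_abs[of n] that by (simp add: has_laplace_integral_iff int_h' h_def[abs_def])
  have lap_F: "laplace_integrable F a b" "laplace_integral F a x = laplace_integral g a x + integral {a..x} k'"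
    if "k absolutely_integrable_on {a..b}" "x \<in> {a..b}" for x
    using lap_shift[of F x] lap_shift[of F b] that
    by (simp_all add: has_laplace_integral_iff int_k' k_def[abs_def])
  have "(laplace_integrable F a b \<and>
          (\<forall>x\<in>{a..b}. (\<lambda>n. laplace_integral (f n) a x) \<longlonglongrightarrow> laplace_integral F a x))
         \<longleftrightarrow> equiabs_continuous (\<lambda>n x. integral {a..x} (h' n)) a b"
  proof (intro iffI conjI ballI)
    assume H: "laplace_integrable F a b \<and>
        (\<forall>x\<in>{a..b}. (\<lambda>n. laplace_integral (f n) a x) \<longlonglongrightarrow> laplace_integral F a x)"
    have "laplace_integrable k a b"
      using has_laplace_integral_diff[OF lap lap[OF assms(3)], of F b] H ab
      by (simp add: has_laplace_integral_iff k_def[abs_def])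
    moreover have "AE x in lebesgue. x \<in> {a..b} \<longrightarrow> 0 \<le> k x"
      using AE
    proof eventually_elim
      case (elim x)
      then show ?case using LIMSEQ_le_const[of "\<lambda>n. h n x" "k x" 0] by blast
    qed
    ultimately have k_abs: "k absolutely_integrable_on {a..b}"
      by (rule laplace_integrable_AE_nonneg[OF _ _ ab])
    then have k'_int: "k' integrable_on {a..b}"
      using absolutely_integrable_spike[OF k_abs N, of k'] set_lebesgue_integral_eq_integral(1)
      by (auto simp: k'_def)
    have "(\<lambda>n. laplace_integral (f n) a b - laplace_integral g a b) \<longlonglongrightarrow> laplace_integral F a b - laplace_integral g a b"
      using H ab by (intro tendsto_diff tendsto_const) auto
    then have "(\<lambda>n. integral {a..b} (h' n)) \<longlonglongrightarrow> integral {a..b} k'"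
      using lap_f[of b] lap_F(2)[OF k_abs, of b] ab by simp
    then show "equiabs_continuous (\<lambda>n x. integral {a..x} (h' n)) a b"
      by (rule tendsto_imp_equiabs_continuous[OF h'_int h'(1) k'_int h'(2), rotated -1])
  next
    assume eq: "equiabs_continuous (\<lambda>n x. integral {a..x} (h' n)) a b"
    note conv = equiabs_continuous_imp_tendsto[where h = h' and k = k', OF h'_int h'(1) h'(2) eq \<open>a < b\<close>]
    have "0 \<le> k' x" if "x \<in> {a..b}" for x
      using h'(2)[OF that] h'(1)[OF that] by (intro LIMSEQ_le_const) auto
    then have "k' absolutely_integrable_on {a..b}"
      using conv(1) by (intro nonnegative_absolutely_integrable_1) auto
    then have k_abs: "k absolutely_integrable_on {a..b}"
      by (rule absolutely_integrable_spike[OF _ N]) (simp add: k'_def)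
    show "laplace_integrable F a b"
      using lap_F(1)[OF k_abs, of b] ab by simp
    show "(\<lambda>n. laplace_integral (f n) a x) \<longlonglongrightarrow> laplace_integral F a x" if "x \<in> {a..b}" for x
      unfolding lap_f[OF that] lap_F(2)[OF k_abs that]
      by (intro tendsto_add tendsto_const conv(2) that)
  qed
  also have "\<dots> \<longleftrightarrow> equiabs_continuous (\<lambda>n x. laplace_integral (\<lambda>t. f n t - g t) a x) a b"
    by (rule equiabs_continuous_cong) (simp add: lap_h)
  finally show ?thesis .
qed

end
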